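(* Let $G$ be a second countable locally compact group and let $E\subset G$ be a closed subset. If $E^*=\{(s,t)\in G\times G : st^{-1}\in E\}$ is synthetic (a set of operator synthesis) with respect to the left Haar measure $m$, then $E$ is a set of local spectral synthesis for the Fourier algebra $A(G)$.
   Context: $A(G)$ is the Fourier algebra of $G$ (coefficient functions $s\mapsto(\lambda(s)\xi,\eta)$, $\xi,\eta\in L^2(G)$, of the left regular representation $\lambda$, with its usual norm). It is a commutative semisimple regular Banach algebra with spectrum $G$. Spectral synthesis. For closed $E\subset G$: $I_A(E)=\{u\in A(G): u=0\text{ on }E\}$; $J_A^0(E)=\{u\in A(G): u=0\text{ on a neighbourhood of }E\}$; $J_A(E)=\overline{J_A^0(E)}$ (norm closure); $I_A^c(E)$ is the set of compactly supported $u\in I_A(E)$. $E$ is a set of spectral synthesis if $J_A(E)=I_A(E)$, and a set of local spectral synthesis if $I_A^c(E)\subset J_A(E)$. Operator synthesis. A subset of $G\times G$ is marginally null if it is contained in $(M\times G)\cup(G\times N)$ with $m(M)=m(N)=0$. Two sets are marginally equivalent if their symmetric difference is marginally null, and a property holds m.a.e. (marginally almost everywhere) if it holds off a marginally null set. A set is pseudo-open if it is marginally equivalent to a countable union of measurable rectangles $A\times B$; complements of pseudo-open sets are pseudo-closed; a pseudo-neighbourhood of $F$ is a pseudo-open set containing $F$ up to a marginally null set. $T(G)=L^2(G)\hat\otimes L^2(G)$ (projective tensor product), whose elements are identified with functions $\Psi(x,y)=\sum_n f_n(x)g_n(y)$, $f_n,g_n\in L^2(G)$, $\sum_n\|f_n\|_2\|g_n\|_2<\infty$,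 defined m.a.e. (functions equal m.a.e. being identified). For pseudo-closed $F\subset G\times G$: $\Phi(F)=\{w\in T(G): w=0\text{ m.a.e. on }F\}$ and $\Phi_0(F)=\overline{\{w\in T(G): w=0\text{ on a pseudo-neighbourhood of }F\}}$ (closure in $T(G)$). $F$ is synthetic, or a set of operator synthesis, with respect to $m$ if $\Phi(F)=\Phi_0(F)$. *)

theory Defs
  imports "HOL-Analysis.Analysis"
begin

text \<open>
  The group is a type of class \<open>topological_group_add\<close>, whose addition is not assumed to be
  commutative.  So \<open>s + t\<close>, \<open>- s\<close>, \<open>s - t\<close> are the products usually written
  \<open>st\<close>, \<open>s\<^sup>-\<^sup>1\<close>, \<open>st\<^sup>-\<^sup>1\<close>.
\<close>

section \<open>Left Haar measure and square-integrable functions\<close>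

definition radon_measure :: "'a::topological_space measure \<Rightarrow> bool" where
  "radon_measure m \<longleftrightarrow>
     sets m = sets borel \<and>
     (\<forall>K. compact K \<longrightarrow> emeasure m K < \<infinity>) \<and>
     (\<forall>A\<in>sets m. emeasure m A = (INF U\<in>{U. open U \<and> A \<subseteq> U}. emeasure m U)) \<and>
     (\<forall>U. open U \<longrightarrow> emeasure m U = (SUP K\<in>{K. compact K \<and> K \<subseteq> U}. emeasure m K))"

definition left_haar_measure :: "'a::topological_group_add measure \<Rightarrow> bool" where
  "left_haar_measure m \<longleftrightarrow>
     radon_measure m \<and> emeasure m UNIV \<noteq> 0 \<and>
     (\<forall>s. \<forall>A\<in>sets m. emeasure m ((+) s ` A) = emeasure m A)"

text \<open>Elements of \<open>L\<^sup>2\<close> are represented by functions, not by classes modulo null sets.\<close>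

definition L2 :: "'a measure \<Rightarrow> ('a \<Rightarrow> complex) set" where
  "L2 m = {f \<in> borel_measurable m. integrable m (\<lambda>x. (cmod (f x))\<^sup>2)}"

definition L2_norm :: "'a measure \<Rightarrow> ('a \<Rightarrow> complex) \<Rightarrow> real" where
  "L2_norm m f = sqrt (LINT x|m. (cmod (f x))\<^sup>2)"


section \<open>The Fourier algebra and local spectral synthesis\<close>

definition left_regular :: "'a::group_add \<Rightarrow> ('a \<Rightarrow> complex) \<Rightarrow> ('a \<Rightarrow> complex)" where
  "left_regular s \<xi> = (\<lambda>t. \<xi> (- s + t))"

definition coefficient ::
  "'a::group_add measure \<Rightarrow> ('a \<Rightarrow> complex) \<Rightarrow> ('a \<Rightarrow> complex) \<Rightarrow> 'a \<Rightarrow> complex" where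
  "coefficient m \<xi> \<eta> s = (LINT t|m. left_regular s \<xi> t * cnj (\<eta> t))"

definition fourier_algebra :: "'a::group_add measure \<Rightarrow> ('a \<Rightarrow> complex) set" where
  "fourier_algebra m = {coefficient m \<xi> \<eta> |\<xi> \<eta>. \<xi> \<in> L2 m \<and> \<eta> \<in> L2 m}"

text \<open>
  The norm of \<open>A(G)\<close> is its norm as predual of the group von Neumann algebra \<open>VN(G)\<close>.  The
  predual is the quotient of the trace-class operators, that is of the projective tensor square of
  \<open>L\<^sup>2(G)\<close> (up to conjugation in one factor), by the annihilator of \<open>VN(G)\<close>; the norm below is
  the quotient norm.  By Eymard's theorem that every normal functional on \<open>VN(G)\<close> is a vector
  functional, it is attained at a single pair, so it is also the minimum of
  \<open>\<parallel>\<xi>\<parallel> \<parallel>\<eta>\<parallel>\<close> over all \<open>\<xi>\<close>, \<open>\<eta>\<close> with \<open>u = coefficient m \<xi> \<eta>\<close>.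
\<close>

definition fourier_norm :: "'a::group_add measure \<Rightarrow> ('a \<Rightarrow> complex) \<Rightarrow> real" where
  "fourier_norm m u =
     Inf {(\<Sum>n. L2_norm m (\<xi> n) * L2_norm m (\<eta> n)) |\<xi> \<eta>.
            (\<forall>n::nat. \<xi> n \<in> L2 m \<and> \<eta> n \<in> L2 m) \<and>
            summable (\<lambda>n. L2_norm m (\<xi> n) * L2_norm m (\<eta> n)) \<and>
            (\<forall>s. (\<lambda>n. coefficient m (\<xi> n) (\<eta> n) s) sums u s)}"

definition I_A :: "'a::group_add measure \<Rightarrow> 'a set \<Rightarrow> ('a \<Rightarrow> complex) set" where
  "I_A m E = {u \<in> fourier_algebra m. \<forall>s\<in>E. u s = 0}"

definition I_A_c :: "'a::topological_group_add measure \<Rightarrow> 'a set \<Rightarrow> ('a \<Rightarrow> complex) set" where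
  "I_A_c m E = {u \<in> I_A m E. compact (closure {s. u s \<noteq> 0})}"

definition J_A_0 :: "'a::topological_group_add measure \<Rightarrow> 'a set \<Rightarrow> ('a \<Rightarrow> complex) set" where
  "J_A_0 m E = {u \<in> fourier_algebra m. \<exists>U. open U \<and> E \<subseteq> U \<and> (\<forall>s\<in>U. u s = 0)}"

definition J_A :: "'a::topological_group_add measure \<Rightarrow> 'a set \<Rightarrow> ('a \<Rightarrow> complex) set" where
  "J_A m E = {u \<in> fourier_algebra m.
     \<forall>\<epsilon>>0. \<exists>v\<in>J_A_0 m E. fourier_norm m (\<lambda>s. u s - v s) < \<epsilon>}"

definition local_spectral_synthesis :: "'a::topological_group_add measure \<Rightarrow> 'a set \<Rightarrow> bool" where
  "local_spectral_synthesis m E \<longleftrightarrow> I_A_c m E \<subseteq> J_A m E"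


section \<open>Operator synthesis\<close>

definition marginally_null :: "'a measure \<Rightarrow> ('a \<times> 'a) set \<Rightarrow> bool" where
  "marginally_null m S \<longleftrightarrow>
     (\<exists>M\<in>null_sets m. \<exists>N\<in>null_sets m. S \<subseteq> (M \<times> UNIV) \<union> (UNIV \<times> N))"

definition marginally_equivalent ::
  "'a measure \<Rightarrow> ('a \<times> 'a) set \<Rightarrow> ('a \<times> 'a) set \<Rightarrow> bool" where
  "marginally_equivalent m S T \<longleftrightarrow> marginally_null m ((S - T) \<union> (T - S))"

definition pseudo_open :: "'a measure \<Rightarrow> ('a \<times> 'a) set \<Rightarrow> bool" where
  "pseudo_open m S \<longleftrightarrow>
     (\<exists>A B. (\<forall>n::nat. A n \<in> sets m \<and> B n \<in> sets m) \<and>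
            marginally_equivalent m S (\<Union>n. A n \<times> B n))"

definition pseudo_neighbourhood ::
  "'a measure \<Rightarrow> ('a \<times> 'a) set \<Rightarrow> ('a \<times> 'a) set \<Rightarrow> bool" where
  "pseudo_neighbourhood m F U \<longleftrightarrow> pseudo_open m U \<and> marginally_null m (F - U)"

definition vanishes_mae_on ::
  "'a measure \<Rightarrow> ('a \<times> 'a \<Rightarrow> complex) \<Rightarrow> ('a \<times> 'a) set \<Rightarrow> bool" where
  "vanishes_mae_on m w S \<longleftrightarrow> marginally_null m {p \<in> S. w p \<noteq> 0}"

text \<open>\<open>T(G)\<close> consists of all functions representing an element of the projective tensor square of
  \<open>L\<^sup>2(G)\<close>; functions equal marginally almost everywhere represent the same element.\<close>

definition represents ::
  "'a measure \<Rightarrow> (nat \<Rightarrow> 'a \<Rightarrow> complex) \<Rightarrow> (nat \<Rightarrow> 'a \<Rightarrow> complex) \<Rightarrow> ('a \<times> 'a \<Rightarrow> complex) \<Rightarrow> bool" where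
  "represents m f g w \<longleftrightarrow>
     (\<forall>n. f n \<in> L2 m \<and> g n \<in> L2 m) \<and>
     summable (\<lambda>n. L2_norm m (f n) * L2_norm m (g n)) \<and>
     marginally_null m {(x, y). \<not> (\<lambda>n. f n x * g n y) sums w (x, y)}"

definition T_space :: "'a measure \<Rightarrow> ('a \<times> 'a \<Rightarrow> complex) set" where
  "T_space m = {w. \<exists>f g. represents m f g w}"

definition T_norm :: "'a measure \<Rightarrow> ('a \<times> 'a \<Rightarrow> complex) \<Rightarrow> real" where
  "T_norm m w = Inf {(\<Sum>n. L2_norm m (f n) * L2_norm m (g n)) |f g. represents m f g w}"

definition Phi :: "'a measure \<Rightarrow> ('a \<times> 'a) set \<Rightarrow> ('a \<times> 'a \<Rightarrow> complex) set" where
  "Phi m F = {w \<in> T_space m. vanishes_mae_on m w F}"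

definition Phi_0 :: "'a measure \<Rightarrow> ('a \<times> 'a) set \<Rightarrow> ('a \<times> 'a \<Rightarrow> complex) set" where
  "Phi_0 m F = {w \<in> T_space m.
     \<forall>\<epsilon>>0. \<exists>v\<in>T_space m. (\<exists>U. pseudo_neighbourhood m F U \<and> vanishes_mae_on m v U) \<and>
       T_norm m (\<lambda>p. w p - v p) < \<epsilon>}"

text \<open>The notion is meant for pseudo-closed \<open>F\<close>.  A closed subset of a second countable square is
  pseudo-closed, since its complement is a countable union of open rectangles.\<close>

definition operator_synthetic :: "'a measure \<Rightarrow> ('a \<times> 'a) set \<Rightarrow> bool" where
  "operator_synthetic m F \<longleftrightarrow> Phi m F = Phi_0 m F"

definition star_set :: "'a::group_add set \<Rightarrow> ('a \<times> 'a) set" where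
  "star_set E = {(s, t). s - t \<in> E}"

end

theory Submission
  imports Defs
begin

text \<open>
  Functions on \<open>G \<times> G\<close> are compared with functions on \<open>G\<close> by integrating over the fibres of
  \<open>(x, y) \<mapsto> x - y\<close>.  An elementary tensor \<open>f(x) g(y)\<close> is sent to \<open>s \<mapsto> \<integral> f(s + y) g(y) dy\<close>, which is a
  coefficient function of the left regular representation, so the map (\<open>fibre_integral\<close> below) does not
  increase norms from \<open>T(G)\<close> to \<open>A(G)\<close>.  In the other direction, a compactly supported \<open>u\<close> in \<open>A(G)\<close>
  is the fibre integral of \<open>w\<^sub>0(x, y) = u(x - y) 1\<^sub>K(x) 1\<^sub>L(y) / m(L)\<close> for suitable compact \<open>K\<close> and \<open>L\<close>.  That
  \<open>w\<^sub>0\<close> belongs to \<open>T(G)\<close> is seen by expanding \<open>u(x - y)\<close>, an inner product of a vector depending on \<open>x\<close>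
  with a vector depending on \<open>y\<close>, along an orthonormal family (\<open>lift_to_tensor_square\<close>).

  Let \<open>u\<close> vanish on \<open>E\<close>.  Then \<open>w\<^sub>0\<close> vanishes on \<open>E\<^sup>*\<close>, and operator synthesis supplies \<open>w\<^sub>1\<close> close to
  \<open>w\<^sub>0\<close> in \<open>T(G)\<close> that vanishes on a pseudo-neighbourhood of \<open>E\<^sup>*\<close>.  The fibre integral of \<open>w\<^sub>1\<close> is close
  to \<open>u\<close>, but two defects have to be repaired.

  A pseudo-neighbourhood is only a measure-theoretic object, so the fibre integral of \<open>w\<^sub>1\<close> need not
  vanish near \<open>E\<close>.  The complement of \<open>E\<^sup>*\<close> is a countable union of open rectangles \<open>A \<times> B\<close> for which
  \<open>A - B - W\<close> misses \<open>E\<close> for some neighbourhood \<open>W\<close> of \<open>0\<close>; together with the rectangles of the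
  pseudo-neighbourhood they cover \<open>G \<times> G\<close> up to a marginally null set, which is itself contained in two
  rectangles.  By outer regularity and compactness finitely many of all these rectangles
  cover \<open>X \<times> Y\<close>, where \<open>X\<close> and \<open>Y\<close> exhaust \<open>G\<close> up to small measure
  (\<open>rectangle_cover_essentially_finite\<close>).  Cutting \<open>w\<^sub>1\<close> down to \<open>X \<times> Y\<close> changes it little in norm, and
  what remains lives on finitely many rectangles \<open>A \<times> B\<close> of the first kind, so its fibre integral is
  carried by finitely many of the sets \<open>A - B\<close> (\<open>localisation\<close>).

  The function \<open>v\<^sub>1\<close> so obtained is a series of coefficient functions, whereas an element of \<open>A(G)\<close> is a
  single one.  But \<open>v\<^sub>1\<close> is bounded and zero off a compact set, hence in \<open>L\<^sup>2\<close>, and therefore its average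
  \<open>s \<mapsto> m(V)\<^sup>-\<^sup>1 \<integral>\<^sub>V v\<^sub>1(s + t) dt\<close> is the single coefficient function of \<open>1\<^sub>V / m(V)\<close> and the conjugate of
  \<open>v\<^sub>1\<close>.  For a small neighbourhood \<open>V\<close> of \<open>0\<close> the average still vanishes near \<open>E\<close>, and it is close to
  \<open>v\<^sub>1\<close> in \<open>A(G)\<close>, because averaging \<open>v\<^sub>1\<close> amounts to averaging left translates of the second tensor
  factors and these translates depend continuously on \<open>t\<close> (\<open>mollification\<close>).
\<close>


section \<open>Square-integrable functions\<close>

lemma L2_measurable: "f \<in> L2 m \<Longrightarrow> f \<in> borel_measurable m"
  by (simp add: L2_def)

lemma L2_integrable: "f \<in> L2 m \<Longrightarrow> integrable m (\<lambda>x. (cmod (f x))\<^sup>2)"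
  by (simp add: L2_def)

lemma L2_norm_nonneg: "0 \<le> L2_norm m f"
  by (simp add: L2_norm_def)

lemma L2_norm_square: "(L2_norm m f)\<^sup>2 = (LINT x|m. (cmod (f x))\<^sup>2)"
  by (simp add: L2_norm_def)

lemma L2_dominated:
  assumes "f \<in> L2 m" "h \<in> borel_measurable m" "\<And>x. cmod (h x) \<le> cmod (f x)"
  shows "h \<in> L2 m" and "L2_norm m h \<le> L2_norm m f"
proof -
  have sq: "(cmod (h x))\<^sup>2 \<le> (cmod (f x))\<^sup>2" for x
    using assms(3) by (intro power_mono) auto
  have int: "integrable m (\<lambda>x. (cmod (h x))\<^sup>2)"
    by (rule Bochner_Integration.integrable_bound[OF L2_integrable[OF assms(1)]])
       (use assms(2) sq in auto)
  then show "h \<in> L2 m" using assms(2) by (simp add: L2_def)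
  show "L2_norm m h \<le> L2_norm m f"
    unfolding L2_norm_def
    by (intro real_sqrt_le_mono integral_mono int L2_integrable[OF assms(1)] sq)
qed

lemma L2_scale:
  assumes "f \<in> L2 m" shows "(\<lambda>x. c * f x) \<in> L2 m"
  using assms by (auto simp: L2_def norm_mult power_mult_distrib)

lemma L2_norm_scale: "L2_norm m (\<lambda>x. c * f x) = cmod c * L2_norm m f"
  by (simp add: L2_norm_def norm_mult power_mult_distrib real_sqrt_mult)

lemma L2_cnj:
  assumes "f \<in> L2 m" shows "(\<lambda>x. cnj (f x)) \<in> L2 m"
  using assms borel_measurable_continuous_onI[OF continuous_on_cnj[OF continuous_on_id]]
  by (auto simp: L2_def intro: measurable_compose)

lemma L2_norm_cnj: "L2_norm m (\<lambda>x. cnj (f x)) = L2_norm m f"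
  by (simp add: L2_norm_def)

lemma L2_add:
  assumes "f \<in> L2 m" "g \<in> L2 m" shows "(\<lambda>x. f x + g x) \<in> L2 m"
proof -
  have le: "(cmod (f x + g x))\<^sup>2 \<le> 2 * (cmod (f x))\<^sup>2 + 2 * (cmod (g x))\<^sup>2" for x
  proof -
    have "(cmod (f x + g x))\<^sup>2 \<le> (cmod (f x) + cmod (g x))\<^sup>2"
      by (intro power_mono norm_triangle_ineq) auto
    also have "\<dots> \<le> 2 * (cmod (f x))\<^sup>2 + 2 * (cmod (g x))\<^sup>2"
      using zero_le_power2[of "cmod (f x) - cmod (g x)"] by (simp add: power2_sum power2_diff)
    finally show ?thesis .
  qed
  have "integrable m (\<lambda>x. (cmod (f x + g x))\<^sup>2)"
    by (rule Bochner_Integration.integrable_bound[where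
          f="\<lambda>x. 2 * (cmod (f x))\<^sup>2 + 2 * (cmod (g x))\<^sup>2"])
       (use assms le L2_measurable[OF assms(1)] L2_measurable[OF assms(2)] in \<open>auto intro!: L2_integrable\<close>)
  then show ?thesis using assms by (auto simp: L2_def)
qed

lemma L2_zero: "(\<lambda>x. 0) \<in> L2 m"
  by (simp add: L2_def)

lemma L2_diff:
  assumes "f \<in> L2 m" "g \<in> L2 m" shows "(\<lambda>x. f x - g x) \<in> L2 m"
  using L2_add[OF assms(1) L2_scale[OF assms(2), of "-1"]] by simp

lemma L2_sum:
  assumes "\<And>i. i \<in> I \<Longrightarrow> f i \<in> L2 m" shows "(\<lambda>x. \<Sum>i\<in>I. f i x) \<in> L2 m"
  using assms
proof (induction I rule: infinite_finite_induct)
  case (insert i I)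
  then show ?case using L2_add[of "f i" m "\<lambda>x. \<Sum>i\<in>I. f i x"] by simp
qed (simp_all add: L2_zero)

lemma L2_mult_integrable:
  assumes "f \<in> L2 m" "g \<in> L2 m" shows "integrable m (\<lambda>x. f x * g x)"
proof -
  have le: "cmod (f x) * cmod (g x) \<le> (cmod (f x))\<^sup>2 + (cmod (g x))\<^sup>2" for x
  proof -
    have "0 \<le> cmod (f x) * cmod (g x)" by simp
    moreover have "0 \<le> (cmod (f x))\<^sup>2 + (cmod (g x))\<^sup>2 - 2 * (cmod (f x) * cmod (g x))"
      using zero_le_power2[of "cmod (f x) - cmod (g x)"] by (simp add: power2_diff mult.assoc)
    ultimately show ?thesis by linarith
  qed
  show ?thesis
    by (rule Bochner_Integration.integrable_bound[where
          f="\<lambda>x. (cmod (f x))\<^sup>2 + (cmod (g x))\<^sup>2"])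
       (use assms le L2_measurable[OF assms(1)] L2_measurable[OF assms(2)] in
         \<open>auto intro!: L2_integrable simp: norm_mult\<close>)
qed

lemma L2_Cauchy_Schwarz:
  assumes "f \<in> L2 m" "g \<in> L2 m"
  shows "(LINT x|m. cmod (f x * g x)) \<le> L2_norm m f * L2_norm m g"
proof -
  define a b c where "a = (LINT x|m. (cmod (f x))\<^sup>2)" and "b = (LINT x|m. (cmod (g x))\<^sup>2)"
    and "c = (LINT x|m. cmod (f x * g x))"
  note [simp] = L2_integrable[OF assms(1)] L2_integrable[OF assms(2)]
    integrable_norm[OF L2_mult_integrable[OF assms]]
  have quad: "0 \<le> a * t\<^sup>2 - 2 * c * t + b" for t
  proof -
    have "0 \<le> (LINT x|m. (t * cmod (f x) - cmod (g x))\<^sup>2)"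
      by simp
    also have "\<dots> = (LINT x|m. t\<^sup>2 * (cmod (f x))\<^sup>2 - 2 * t * cmod (f x * g x) + (cmod (g x))\<^sup>2)"
      by (intro Bochner_Integration.integral_cong) (auto simp: power2_diff power_mult_distrib norm_mult)
    also have "\<dots> = a * t\<^sup>2 - 2 * c * t + b"
      by (simp add: a_def b_def c_def)
    finally show ?thesis .
  qed
  have "0 \<le> a" "0 \<le> b" "0 \<le> c" by (simp_all add: a_def b_def c_def)
  have "c\<^sup>2 \<le> a * b"
  proof (cases "a = 0")
    case True
    have "c = 0"
    proof (rule ccontr)
      assume "c \<noteq> 0"
      with quad[of "(b + 1) / (2 * c)"] True show False by simp
    qed
    then show ?thesis using True by simp
  next
    case False
    with \<open>0 \<le> a\<close> have "0 < a" by simp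
    from quad[of "c / a"] have "0 \<le> a * (c / a)\<^sup>2 - 2 * c * (c / a) + b" .
    also have "\<dots> = b - c\<^sup>2 / a" using \<open>0 < a\<close> by (simp add: power2_eq_square)
    finally show ?thesis using \<open>0 < a\<close> by (simp add: field_simps)
  qed
  then have "c \<le> sqrt (a * b)" using \<open>0 \<le> c\<close> by (intro real_le_rsqrt) auto
  then show ?thesis by (simp add: a_def b_def c_def L2_norm_def real_sqrt_mult)
qed

lemma L2_Cauchy_Schwarz_norm:
  assumes "f \<in> L2 m" "g \<in> L2 m"
  shows "cmod (LINT x|m. f x * g x) \<le> L2_norm m f * L2_norm m g"
  using integral_norm_bound[of m "\<lambda>x. f x * g x"] L2_Cauchy_Schwarz[OF assms] by linarith

lemma L2_triangle:
  assumes "f \<in> L2 m" "g \<in> L2 m"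
  shows "L2_norm m (\<lambda>x. f x + g x) \<le> L2_norm m f + L2_norm m g"
proof -
  note [simp] = L2_integrable[OF assms(1)] L2_integrable[OF assms(2)]
    integrable_norm[OF L2_mult_integrable[OF assms]]
  have "(LINT x|m. (cmod (f x + g x))\<^sup>2)
      \<le> (LINT x|m. (cmod (f x))\<^sup>2 + 2 * cmod (f x * g x) + (cmod (g x))\<^sup>2)"
  proof (rule integral_mono)
    show "(cmod (f x + g x))\<^sup>2 \<le> (cmod (f x))\<^sup>2 + 2 * cmod (f x * g x) + (cmod (g x))\<^sup>2" for x
      using power_mono[OF norm_triangle_ineq[of "f x" "g x"], of 2]
      by (simp add: power2_sum norm_mult)
  qed (use L2_integrable[OF L2_add[OF assms]] in auto)
  also have "\<dots> = (L2_norm m f)\<^sup>2 + 2 * (LINT x|m. cmod (f x * g x)) + (L2_norm m g)\<^sup>2"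
    by (simp add: L2_norm_square)
  also have "\<dots> \<le> (L2_norm m f + L2_norm m g)\<^sup>2"
    using L2_Cauchy_Schwarz[OF assms] by (simp add: power2_sum)
  finally show ?thesis
    unfolding L2_norm_def[of m "\<lambda>x. f x + g x"]
    by (intro real_le_lsqrt) (auto simp: L2_norm_nonneg)
qed

lemma L2_triangle_diff:
  assumes "f \<in> L2 m" "g \<in> L2 m"
  shows "L2_norm m (\<lambda>x. f x - g x) \<le> L2_norm m f + L2_norm m g"
  using L2_triangle[OF assms(1) L2_scale[OF assms(2), of "-1"]] L2_norm_scale[of m "-1" g] by simp

lemma L2_norm_cong_AE:
  assumes "f \<in> L2 m" "g \<in> L2 m" "AE x in m. f x = g x"
  shows "L2_norm m f = L2_norm m g"
proof -
  note [measurable] = L2_measurable[OF assms(1)] L2_measurable[OF assms(2)]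
  have "(LINT x|m. (cmod (f x))\<^sup>2) = (LINT x|m. (cmod (g x))\<^sup>2)"
    by (intro integral_cong_AE) (use assms(3) in auto)
  then show ?thesis by (simp add: L2_norm_def)
qed

lemma L2_dominated_convergence:
  assumes f: "f \<in> L2 m" and h: "\<And>k. h k \<in> borel_measurable m"
    and bound: "\<And>k x. cmod (h k x) \<le> cmod (f x)"
    and lim: "AE x in m. (\<lambda>k. h k x) \<longlonglongrightarrow> 0"
  shows "(\<lambda>k. L2_norm m (h k)) \<longlonglongrightarrow> 0"
proof -
  have "(\<lambda>k. LINT x|m. (cmod (h k x))\<^sup>2) \<longlonglongrightarrow> (LINT x|m. 0)"
  proof (rule integral_dominated_convergence[where w="\<lambda>x. (cmod (f x))\<^sup>2"])
    show "AE x in m. (\<lambda>k. (cmod (h k x))\<^sup>2) \<longlonglongrightarrow> 0"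
      using lim
    proof eventually_elim
      case (elim x)
      then have "(\<lambda>k. (cmod (h k x))\<^sup>2) \<longlonglongrightarrow> (cmod 0)\<^sup>2" by (intro tendsto_intros)
      then show ?case by simp
    qed
    show "AE x in m. norm ((cmod (h k x))\<^sup>2) \<le> (cmod (f x))\<^sup>2" for k
      using bound by (auto intro!: power_mono)
  qed (use f h in \<open>auto intro!: L2_integrable\<close>)
  then have "(\<lambda>k. sqrt (LINT x|m. (cmod (h k x))\<^sup>2)) \<longlonglongrightarrow> sqrt 0"
    by (intro tendsto_real_sqrt) simp
  then show ?thesis by (simp add: L2_norm_def)
qed

lemma L2_indicator:
  assumes "f \<in> L2 m" "A \<in> sets m"
  shows "(\<lambda>x. indicator A x * f x) \<in> L2 m"
    and "L2_norm m (\<lambda>x. indicator A x * f x) \<le> L2_norm m f"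
proof -
  have "(\<lambda>x. indicator A x * f x) \<in> borel_measurable m"
    using assms by (intro borel_measurable_times borel_measurable_indicator L2_measurable) auto
  moreover have "cmod (indicator A x * f x) \<le> cmod (f x)" for x
    by (simp add: indicator_def)
  ultimately show "(\<lambda>x. indicator A x * f x) \<in> L2 m"
    and "L2_norm m (\<lambda>x. indicator A x * f x) \<le> L2_norm m f"
    using L2_dominated[OF assms(1)] by auto
qed


section \<open>Orthonormal families\<close>

definition l2_inner :: "'a measure \<Rightarrow> ('a \<Rightarrow> complex) \<Rightarrow> ('a \<Rightarrow> complex) \<Rightarrow> complex" where
  "l2_inner m f g = (LINT x|m. f x * cnj (g x))"

lemma l2_inner_integrable:
  "f \<in> L2 m \<Longrightarrow> g \<in> L2 m \<Longrightarrow> integrable m (\<lambda>x. f x * cnj (g x))"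
  by (intro L2_mult_integrable L2_cnj)

lemma l2_inner_diff_left:
  "f \<in> L2 m \<Longrightarrow> f' \<in> L2 m \<Longrightarrow> g \<in> L2 m \<Longrightarrow>
    l2_inner m (\<lambda>x. f x - f' x) g = l2_inner m f g - l2_inner m f' g"
  by (simp add: l2_inner_def left_diff_distrib l2_inner_integrable)

lemma l2_inner_scale_left: "l2_inner m (\<lambda>x. c * f x) g = c * l2_inner m f g"
  by (simp add: l2_inner_def mult.assoc)

lemma l2_inner_commute: "l2_inner m g f = cnj (l2_inner m f g)"
proof -
  have "l2_inner m g f = (LINT x|m. cnj (f x * cnj (g x)))"
    by (simp add: l2_inner_def mult.commute)
  then show ?thesis by (simp only: Bochner_Integration.integral_cnj l2_inner_def)
qed

lemma l2_inner_sum_left: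
  assumes "\<And>i. i \<in> I \<Longrightarrow> f i \<in> L2 m" "g \<in> L2 m"
  shows "l2_inner m (\<lambda>x. \<Sum>i\<in>I. f i x) g = (\<Sum>i\<in>I. l2_inner m (f i) g)"
proof -
  have "l2_inner m (\<lambda>x. \<Sum>i\<in>I. f i x) g = (LINT x|m. (\<Sum>i\<in>I. f i x * cnj (g x)))"
    by (simp add: l2_inner_def sum_distrib_right)
  also have "\<dots> = (\<Sum>i\<in>I. l2_inner m (f i) g)"
    unfolding l2_inner_def using assms by (intro Bochner_Integration.integral_sum l2_inner_integrable)
  finally show ?thesis .
qed

lemma l2_inner_self: "l2_inner m f f = of_real ((L2_norm m f)\<^sup>2)"
  by (simp only: l2_inner_def complex_norm_square[symmetric] integral_complex_of_real L2_norm_square)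

lemma l2_inner_bound:
  "f \<in> L2 m \<Longrightarrow> g \<in> L2 m \<Longrightarrow> cmod (l2_inner m f g) \<le> L2_norm m f * L2_norm m g"
  unfolding l2_inner_def using L2_Cauchy_Schwarz_norm[OF _ L2_cnj, of f m g]
  by (simp add: L2_norm_cnj)

text \<open>
  Zero members are admitted so that the Gram-Schmidt procedure applies to arbitrary sequences of
  vectors, linearly dependent ones included.
\<close>

definition orthonormal_or_zero :: "'a measure \<Rightarrow> (nat \<Rightarrow> 'a \<Rightarrow> complex) \<Rightarrow> bool" where
  "orthonormal_or_zero m e \<longleftrightarrow>
     (\<forall>i. e i \<in> L2 m \<and> (e i = (\<lambda>x. 0) \<or> L2_norm m (e i) = 1)) \<and>
     (\<forall>i j. i \<noteq> j \<longrightarrow> l2_inner m (e i) (e j) = 0)"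

definition projection ::
  "'a measure \<Rightarrow> (nat \<Rightarrow> 'a \<Rightarrow> complex) \<Rightarrow> nat \<Rightarrow> ('a \<Rightarrow> complex) \<Rightarrow> 'a \<Rightarrow> complex" where
  "projection m e n f = (\<lambda>x. \<Sum>i<n. l2_inner m f (e i) * e i x)"

lemma projection_L2:
  "(\<And>i. i < n \<Longrightarrow> e i \<in> L2 m) \<Longrightarrow> projection m e n f \<in> L2 m"
  unfolding projection_def by (intro L2_sum L2_scale) auto

lemma orthonormal_inner_projection:
  assumes e: "orthonormal_or_zero m e" and "i < n"
  shows "l2_inner m (projection m e n f) (e i) = l2_inner m f (e i)"
proof -
  have eL: "e j \<in> L2 m" for j using e by (simp add: orthonormal_or_zero_def)
  have "l2_inner m (projection m e n f) (e i) = (\<Sum>j<n. l2_inner m f (e j) * l2_inner m (e j) (e i))"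
    unfolding projection_def using eL
    by (subst l2_inner_sum_left) (auto intro: L2_scale simp: l2_inner_scale_left)
  also have "\<dots> = (\<Sum>j\<in>{i}. l2_inner m f (e j) * l2_inner m (e j) (e i))"
    using e \<open>i < n\<close> by (intro sum.mono_neutral_right) (auto simp: orthonormal_or_zero_def)
  also have "\<dots> = l2_inner m f (e i)"
  proof (cases "e i = (\<lambda>x. 0)")
    case True then show ?thesis by (simp add: l2_inner_def)
  next
    case False
    then have "L2_norm m (e i) = 1" using e by (auto simp: orthonormal_or_zero_def)
    then show ?thesis by (simp add: l2_inner_self)
  qed
  finally show ?thesis .
qed

lemma projection_Pythagoras:
  assumes e: "orthonormal_or_zero m e" and f: "f \<in> L2 m"
  shows "(\<Sum>i<n. (cmod (l2_inner m f (e i)))\<^sup>2) + (L2_norm m (\<lambda>x. f x - projection m e n f x))\<^sup>2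
       = (L2_norm m f)\<^sup>2"
proof -
  define p where "p = projection m e n f"
  have eL: "e j \<in> L2 m" for j using e by (simp add: orthonormal_or_zero_def)
  then have p: "p \<in> L2 m" unfolding p_def by (intro projection_L2)
  have pg: "l2_inner m p g = (\<Sum>i<n. l2_inner m f (e i) * l2_inner m (e i) g)" if "g \<in> L2 m" for g
    unfolding p_def projection_def using eL that
    by (subst l2_inner_sum_left) (auto intro: L2_scale simp: l2_inner_scale_left)
  have S: "complex_of_real (\<Sum>i<n. (cmod (l2_inner m f (e i)))\<^sup>2) = l2_inner m p g"
    if "g \<in> L2 m" "\<And>i. i < n \<Longrightarrow> l2_inner m g (e i) = l2_inner m f (e i)" for g
    unfolding pg[OF that(1)] of_real_sum complex_norm_square
    by (intro sum.cong refl) (metis lessThan_iff l2_inner_commute that(2))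
  have pp: "l2_inner m p p = l2_inner m p f"
    using S[of f] S[of p] f p orthonormal_inner_projection[OF e] by (simp add: p_def)
  have fp: "l2_inner m f p = l2_inner m p f"
    using S[of f] f by (metis l2_inner_commute complex_cnj_complex_of_real)
  have d: "(\<lambda>x. f x - p x) \<in> L2 m" by (rule L2_diff[OF f p])
  have fd: "l2_inner m g (\<lambda>x. f x - p x) = l2_inner m g f - l2_inner m g p" if "g \<in> L2 m" for g
    by (metis l2_inner_commute l2_inner_diff_left[OF f p that] complex_cnj_diff)
  have "complex_of_real ((L2_norm m (\<lambda>x. f x - p x))\<^sup>2) = l2_inner m f f - l2_inner m p f"
    unfolding l2_inner_self[symmetric] l2_inner_diff_left[OF f p d] fd[OF f] fd[OF p]
    by (simp add: pp fp)
  then have "complex_of_real ((L2_norm m (\<lambda>x. f x - p x))\<^sup>2 + (\<Sum>i<n. (cmod (l2_inner m f (e i)))\<^sup>2))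
    = complex_of_real ((L2_norm m f)\<^sup>2)"
    using S[of f] f by (simp add: l2_inner_self del: of_real_sum of_real_power)
  then show ?thesis unfolding of_real_eq_iff p_def by simp
qed

lemma Bessel:
  assumes "orthonormal_or_zero m e" "f \<in> L2 m"
  shows "(\<Sum>i<n. (cmod (l2_inner m f (e i)))\<^sup>2) \<le> (L2_norm m f)\<^sup>2"
  using projection_Pythagoras[OF assms, of n] zero_le_power2[of "L2_norm m (\<lambda>x. f x - projection m e n f x)"]
  by linarith

lemma projection_contraction:
  assumes "orthonormal_or_zero m e" "f \<in> L2 m"
  shows "L2_norm m (\<lambda>x. f x - projection m e n f x) \<le> L2_norm m f"
proof -
  have "0 \<le> (\<Sum>i<n. (cmod (l2_inner m f (e i)))\<^sup>2)" by (intro sum_nonneg) auto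
  then have "(L2_norm m (\<lambda>x. f x - projection m e n f x))\<^sup>2 \<le> (L2_norm m f)\<^sup>2"
    using projection_Pythagoras[OF assms, of n] by linarith
  then show ?thesis by (rule power2_le_imp_le) (rule L2_norm_nonneg)
qed

text \<open>
  A remainder of norm zero is multiplied by \<open>inverse 0 = 0\<close>, so it produces the zero function itself
  and not merely a function vanishing almost everywhere.
\<close>

fun gram_schmidt :: "'a measure \<Rightarrow> (nat \<Rightarrow> 'a \<Rightarrow> complex) \<Rightarrow> nat \<Rightarrow> 'a \<Rightarrow> complex" where
  "gram_schmidt m v n =
     (let r = (\<lambda>x. v n x - (\<Sum>i<n. l2_inner m (v n) (gram_schmidt m v i) * gram_schmidt m v i x))
      in (\<lambda>x. of_real (inverse (L2_norm m r)) * r x))"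

declare gram_schmidt.simps [simp del]

lemma gram_schmidt_eq:
  "gram_schmidt m v n = (\<lambda>x. of_real (inverse (L2_norm m (\<lambda>x. v n x - projection m (gram_schmidt m v) n (v n) x)))
      * (v n x - projection m (gram_schmidt m v) n (v n) x))"
  by (subst gram_schmidt.simps) (simp add: projection_def Let_def)

lemma gram_schmidt_L2:
  assumes "\<And>n. v n \<in> L2 m" shows "gram_schmidt m v n \<in> L2 m"
proof (induction n rule: less_induct)
  case (less n)
  show ?case
    by (subst gram_schmidt_eq) (intro L2_scale L2_diff assms projection_L2 less)
qed

lemma gram_schmidt_orthonormal:
  assumes v: "\<And>n. v n \<in> L2 m" shows "orthonormal_or_zero m (gram_schmidt m v)"
proof -
  define e where "e = gram_schmidt m v"
  define r where "r n = (\<lambda>x. v n x - projection m e n (v n) x)" for n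
  have eL: "e n \<in> L2 m" for n unfolding e_def by (rule gram_schmidt_L2[OF v])
  have rL: "r n \<in> L2 m" for n unfolding r_def by (intro L2_diff v projection_L2 eL)
  have e_eq: "e n = (\<lambda>x. of_real (inverse (L2_norm m (r n))) * r n x)" for n
    unfolding e_def r_def by (rule gram_schmidt_eq)
  have nrm: "e n = (\<lambda>x. 0) \<or> L2_norm m (e n) = 1" for n
  proof (cases "L2_norm m (r n) = 0")
    case True then show ?thesis by (simp add: e_eq[of n])
  next
    case False
    have "L2_norm m (e n) = cmod (of_real (inverse (L2_norm m (r n)))) * L2_norm m (r n)"
      by (subst e_eq) (rule L2_norm_scale)
    then show ?thesis using False L2_norm_nonneg[of m "r n"] by (simp add: norm_inverse)
  qed
  have orth: "l2_inner m (e n) (e i) = 0" if "i < n" for i n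
    using that
  proof (induction n arbitrary: i rule: less_induct)
    case (less n)
    have "l2_inner m (projection m e n (v n)) (e i) = (\<Sum>j<n. l2_inner m (v n) (e j) * l2_inner m (e j) (e i))"
      unfolding projection_def using eL
      by (subst l2_inner_sum_left) (auto intro: L2_scale simp: l2_inner_scale_left)
    also have "\<dots> = (\<Sum>j\<in>{i}. l2_inner m (v n) (e j) * l2_inner m (e j) (e i))"
    proof (intro sum.mono_neutral_right ballI)
      fix j assume j: "j \<in> {..<n} - {i}"
      show "l2_inner m (v n) (e j) * l2_inner m (e j) (e i) = 0"
      proof (cases "i < j")
        case True then show ?thesis using less.IH[of j i] j by simp
      next
        case False
        then have "l2_inner m (e i) (e j) = 0" using less.IH[of i j] j less.prems by auto
        then show ?thesis using l2_inner_commute[of m "e j" "e i"] by simp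
      qed
    qed (use less.prems in auto)
    also have "\<dots> = l2_inner m (v n) (e i)"
      using nrm[of i] by (auto simp: l2_inner_self) (simp add: l2_inner_def)
    finally have "l2_inner m (r n) (e i) = 0"
      unfolding r_def by (subst l2_inner_diff_left) (auto intro: v eL projection_L2)
    then show ?case by (simp add: e_eq[of n] l2_inner_scale_left)
  qed
  have "l2_inner m (e i) (e j) = 0" if "i \<noteq> j" for i j
    using orth[of i j] orth[of j i] l2_inner_commute[of m "e i" "e j"] that by (cases "i < j") auto
  with eL nrm show ?thesis unfolding e_def[symmetric] orthonormal_or_zero_def by blast
qed

text \<open>
  By Pythagoras the squared norm of \<open>v k\<close> is the sum of its first \<open>k\<close> squared coefficients and the
  squared norm of the remainder, and the coefficient number \<open>k\<close> equals the norm of that remainder.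
  Nothing is left after \<open>k + 1\<close> steps.
\<close>

lemma gram_schmidt_projection:
  assumes v: "\<And>n. v n \<in> L2 m" and "k < n"
  shows "L2_norm m (\<lambda>x. v k x - projection m (gram_schmidt m v) n (v k) x) = 0"
proof -
  define e where "e = gram_schmidt m v"
  define r where "r = (\<lambda>x. v k x - projection m e k (v k) x)"
  have e: "orthonormal_or_zero m e" unfolding e_def by (rule gram_schmidt_orthonormal[OF v])
  have eL: "e n \<in> L2 m" for n unfolding e_def by (rule gram_schmidt_L2[OF v])
  have rL: "r \<in> L2 m" unfolding r_def by (intro L2_diff v projection_L2 eL)
  have e_eq: "e k = (\<lambda>x. of_real (inverse (L2_norm m r)) * r x)"
    unfolding e_def r_def by (rule gram_schmidt_eq)
  have pyth: "(\<Sum>i<j. (cmod (l2_inner m (v k) (e i)))\<^sup>2) + (L2_norm m (\<lambda>x. v k x - projection m e j (v k) x))\<^sup>2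
       = (L2_norm m (v k))\<^sup>2" for j
    by (rule projection_Pythagoras[OF e v])
  have "l2_inner m r (e k) = l2_inner m (v k) (e k)"
  proof -
    have "l2_inner m (projection m e k (v k)) (e k) = (\<Sum>j<k. l2_inner m (v k) (e j) * l2_inner m (e j) (e k))"
      unfolding projection_def using eL
      by (subst l2_inner_sum_left) (auto intro: L2_scale simp: l2_inner_scale_left)
    also have "\<dots> = 0" using e by (intro sum.neutral) (auto simp: orthonormal_or_zero_def)
    finally show ?thesis unfolding r_def
      by (subst l2_inner_diff_left) (auto intro: v eL projection_L2)
  qed
  moreover have "l2_inner m r (e k) = of_real (L2_norm m r)"
  proof -
    have "l2_inner m (e k) r = of_real (inverse (L2_norm m r)) * l2_inner m r r"
      unfolding e_eq by (rule l2_inner_scale_left)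
    then have "l2_inner m (e k) r = of_real (L2_norm m r)"
      by (cases "L2_norm m r = 0") (simp_all add: l2_inner_self power2_eq_square)
    then show ?thesis by (metis l2_inner_commute complex_cnj_complex_of_real)
  qed
  ultimately have "(cmod (l2_inner m (v k) (e k)))\<^sup>2 = (L2_norm m r)\<^sup>2"
    by (metis norm_of_real power2_abs)
  moreover have "(\<Sum>i<Suc k. (cmod (l2_inner m (v k) (e i)))\<^sup>2) \<le> (\<Sum>i<n. (cmod (l2_inner m (v k) (e i)))\<^sup>2)"
    using \<open>k < n\<close> by (intro sum_mono2) auto
  ultimately have "(L2_norm m (\<lambda>x. v k x - projection m e n (v k) x))\<^sup>2 \<le> 0"
    using pyth[of n] pyth[of k] unfolding r_def sum.lessThan_Suc by linarith
  then show ?thesis unfolding e_def by simp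
qed

text \<open>
  Passing to the remainder \<open>f - projection m e n f\<close> does not increase norms.  So it suffices that \<open>f\<close> is a
  limit of vectors that the projections eventually reproduce, and completeness of the family \<open>e\<close> is
  only tested on the one vector \<open>f\<close>.
\<close>

lemma Parseval_of_approximation:
  assumes e: "orthonormal_or_zero m e" and f: "f \<in> L2 m" and g: "g \<in> L2 m"
    and dense: "\<And>\<epsilon>. \<epsilon> > 0 \<Longrightarrow> \<exists>h k. h \<in> L2 m \<and> L2_norm m (\<lambda>x. f x - h x) < \<epsilon> \<and>
                  (\<forall>n\<ge>k. L2_norm m (\<lambda>x. h x - projection m e n h x) = 0)"
  shows "(\<lambda>i. l2_inner m f (e i) * l2_inner m (e i) g) sums l2_inner m f g"
proof -
  have eL: "e n \<in> L2 m" for n using e by (simp add: orthonormal_or_zero_def)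
  have part: "(\<Sum>i<n. l2_inner m f (e i) * l2_inner m (e i) g) = l2_inner m (projection m e n f) g" for n
    unfolding projection_def using eL g
    by (subst l2_inner_sum_left) (auto intro: L2_scale simp: l2_inner_scale_left)
  have "(\<lambda>n. L2_norm m (\<lambda>x. f x - projection m e n f x)) \<longlonglongrightarrow> 0"
  proof (rule LIMSEQ_I)
    fix \<epsilon> :: real assume "\<epsilon> > 0"
    from dense[OF this] obtain h k where h: "h \<in> L2 m" "L2_norm m (\<lambda>x. f x - h x) < \<epsilon>"
      and k: "\<And>n. n \<ge> k \<Longrightarrow> L2_norm m (\<lambda>x. h x - projection m e n h x) = 0" by blast
    have "norm (L2_norm m (\<lambda>x. f x - projection m e n f x) - 0) < \<epsilon>" if "n \<ge> k" for n
    proof -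
      define d where "d = (\<lambda>x. f x - h x)"
      have d: "d \<in> L2 m" unfolding d_def by (intro L2_diff f h)
      have pd: "projection m e n d x = projection m e n f x - projection m e n h x" for x
        unfolding projection_def d_def
        by (subst l2_inner_diff_left[OF f h(1) eL]) (simp add: left_diff_distrib sum_subtractf)
      have "L2_norm m (\<lambda>x. f x - projection m e n f x)
          = L2_norm m (\<lambda>x. (d x - projection m e n d x) + (h x - projection m e n h x))"
        unfolding pd by (simp add: d_def)
      also have "\<dots> \<le> L2_norm m (\<lambda>x. d x - projection m e n d x)
          + L2_norm m (\<lambda>x. h x - projection m e n h x)"
        by (intro L2_triangle L2_diff projection_L2 d h eL)
      also have "\<dots> \<le> L2_norm m d" using projection_contraction[OF e d, of n] k[OF that] by simp
      also have "\<dots> < \<epsilon>" using h by (simp add: d_def)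
      finally show ?thesis using L2_norm_nonneg[of m] by simp
    qed
    then show "\<exists>no. \<forall>n\<ge>no. norm (L2_norm m (\<lambda>x. f x - projection m e n f x) - 0) < \<epsilon>" by blast
  qed
  then have lim: "(\<lambda>n. L2_norm m (\<lambda>x. f x - projection m e n f x) * L2_norm m g) \<longlonglongrightarrow> 0"
    by (rule tendsto_mult_left_zero)
  have "(\<lambda>n. l2_inner m f g - l2_inner m (projection m e n f) g) \<longlonglongrightarrow> 0"
  proof (rule Lim_null_comparison[OF _ lim], rule always_eventually, rule allI)
    fix n
    show "cmod (l2_inner m f g - l2_inner m (projection m e n f) g)
        \<le> L2_norm m (\<lambda>x. f x - projection m e n f x) * L2_norm m g"
      using l2_inner_bound[OF L2_diff[OF f projection_L2[of n e m f]] g] eL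
      by (simp add: l2_inner_diff_left[OF f projection_L2 g])
  qed
  from tendsto_diff[OF tendsto_const[of "l2_inner m f g"] this]
  show ?thesis unfolding sums_def part by simp
qed


section \<open>Translation invariance and regularity of Haar measure\<close>

lemma compact_subset_open_translates:
  fixes K U :: "'a::topological_group_add set"
  assumes "compact K" "open U" "K \<subseteq> U"
  shows "\<forall>\<^sub>F t in nhds 0. \<forall>k\<in>K. t + k \<in> U"
proof -
  have "\<exists>A B. open A \<and> k \<in> A \<and> open B \<and> 0 \<in> B \<and> (\<forall>a\<in>A. \<forall>t\<in>B. t + a \<in> U)" if "k \<in> K" for k
  proof -
    have "((\<lambda>p. snd p + fst p) \<longlongrightarrow> 0 + k) (nhds k \<times>\<^sub>F nhds 0)"
      by (intro tendsto_add filterlim_fst filterlim_snd)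
    then have "\<forall>\<^sub>F p in nhds k \<times>\<^sub>F nhds 0. snd p + fst p \<in> U"
      using assms that by (intro topological_tendstoD) auto
    then show ?thesis
      unfolding eventually_prod_filter eventually_nhds by simp (meson order_refl)
  qed
  then obtain A B where AB: "\<And>k. k \<in> K \<Longrightarrow> open (A k) \<and> k \<in> A k \<and> open (B k) \<and> 0 \<in> B k \<and>
      (\<forall>a\<in>A k. \<forall>t\<in>B k. t + a \<in> U)"
    by metis
  obtain F where F: "F \<subseteq> K" "finite F" "K \<subseteq> (\<Union>k\<in>F. A k)"
    by (rule compactE_image[OF assms(1), of K A]) (use AB in auto)
  have "\<forall>\<^sub>F t in nhds 0. \<forall>k\<in>F. t \<in> B k"
    using F AB by (intro eventually_ball_finite ballI eventually_nhds_in_open) auto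
  then show ?thesis
    by eventually_elim (use F AB in blast)
qed

locale haar_group =
  fixes m :: "'a::{topological_group_add, t2_space, second_countable_topology} measure"
  assumes locally_compact: "locally_compact_space (euclidean :: 'a topology)"
    and haar: "left_haar_measure m"
begin

lemma sets_haar [measurable_cong, simp]: "sets m = sets borel"
  using haar by (simp add: left_haar_measure_def radon_measure_def)

lemma space_haar [simp]: "space m = UNIV"
  using sets_eq_imp_space_eq[OF sets_haar] by simp

lemma emeasure_translate: "A \<in> sets borel \<Longrightarrow> emeasure m ((+) s ` A) = emeasure m A"
  using haar by (simp add: left_haar_measure_def)

lemma emeasure_compact: "compact K \<Longrightarrow> emeasure m K < \<infinity>"
  using haar by (simp add: left_haar_measure_def radon_measure_def)

lemma measurable_uminus_group [measurable (raw)]: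
  "f \<in> borel_measurable N \<Longrightarrow> (\<lambda>x. - f x :: 'a) \<in> borel_measurable N"
  by (rule measurable_compose[OF _ borel_measurable_continuous_onI])
     (auto simp: continuous_on_def intro!: tendsto_intros)

lemma distr_translate: "distr m m ((+) s) = m"
proof (rule measure_eqI)
  fix A assume "A \<in> sets (distr m m ((+) s))"
  then have A: "A \<in> sets borel" by simp
  have eq: "(+) s -` A = (+) (- s) ` A"
    by (auto simp: image_iff) (metis minus_add_cancel)
  have "emeasure (distr m m ((+) s)) A = emeasure m ((+) s -` A)"
    by (subst emeasure_distr) (use A in auto)
  then show "emeasure (distr m m ((+) s)) A = emeasure m A"
    using emeasure_translate[OF A, of "- s"] by (simp add: eq)
qed simp

lemma integrable_translate:
  fixes f :: "'a \<Rightarrow> 'b::{banach, second_countable_topology}"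
  shows "integrable m f \<Longrightarrow> integrable m (\<lambda>x. f (s + x))"
  using integrable_distr[of "(+) s" m m f] distr_translate by simp

lemma integral_translate:
  fixes f :: "'a \<Rightarrow> 'b::{banach, second_countable_topology}"
  shows "f \<in> borel_measurable m \<Longrightarrow> (LINT x|m. f (s + x)) = (LINT x|m. f x)"
  using integral_distr[of "(+) s" m m f] distr_translate by simp

lemma AE_translate:
  assumes "AE x in m. P x" shows "AE x in m. P (s + x)"
proof -
  from assms obtain N where N: "{x. \<not> P x} \<subseteq> N" "N \<in> null_sets m"
    unfolding eventually_ae_filter by auto
  have eq: "(+) s -` N = (+) (- s) ` N"
    by (auto simp: image_iff) (metis minus_add_cancel)
  have "(+) s -` N \<in> sets borel"
    using N measurable_sets[of "(+) s" borel borel N] by (simp add: null_sets_def)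
  then have "(+) s -` N \<in> null_sets m"
    using N emeasure_translate[of N "- s"] by (auto simp: null_sets_def eq)
  then show ?thesis using N by (intro AE_I') auto
qed

lemma L2_translate:
  assumes "f \<in> L2 m"
  shows "(\<lambda>x. f (s + x)) \<in> L2 m" and "L2_norm m (\<lambda>x. f (s + x)) = L2_norm m f"
proof -
  note [measurable] = L2_measurable[OF assms]
  show "(\<lambda>x. f (s + x)) \<in> L2 m"
    using integrable_translate[OF L2_integrable[OF assms], of s] by (simp add: L2_def)
  show "L2_norm m (\<lambda>x. f (s + x)) = L2_norm m f"
    unfolding L2_norm_def by (subst integral_translate[where f="\<lambda>x. (cmod (f x))\<^sup>2"]) auto
qed

lemma L2_norm_diff_translate:
  assumes "f \<in> L2 m" "g \<in> L2 m"
  shows "L2_norm m (\<lambda>x. f (s + x) - g (s + x)) = L2_norm m (\<lambda>x. f x - g x)"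
  using L2_translate(2)[OF L2_diff[OF assms]] .

lemma compact_exhaustion:
  obtains K :: "nat \<Rightarrow> 'a set"
  where "\<And>n. compact (K n)" "\<And>i j. i \<le> j \<Longrightarrow> K i \<subseteq> K j" "(\<Union>n. K n) = UNIV"
proof -
  define \<F> where "\<F> = {U :: 'a set. open U \<and> (\<exists>C. compact C \<and> U \<subseteq> C)}"
  have cover: "\<Union>\<F> = UNIV"
    using locally_compact unfolding locally_compact_space_def \<F>_def by auto metis
  obtain \<G> where \<G>: "\<G> \<subseteq> \<F>" "countable \<G>" "\<Union>\<G> = \<Union>\<F>"
    by (rule Lindelof[of \<F>]) (auto simp: \<F>_def)
  have ne: "\<G> \<noteq> {}" using \<G> cover by auto
  define U where "U = from_nat_into \<G>"
  have "U n \<in> \<G>" for n unfolding U_def by (rule from_nat_into[OF ne])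
  then have "\<exists>C. compact C \<and> U n \<subseteq> C" for n using \<G> unfolding \<F>_def by blast
  then obtain C where C: "\<And>n. compact (C n)" "\<And>n. U n \<subseteq> C n" by metis
  have "(\<Union>n. U n) = UNIV"
    using \<G> cover range_from_nat_into[OF ne \<G>(2)] by (simp add: U_def)
  then have "(\<Union>n. C n) = UNIV" using C(2) by blast
  then have "(\<Union>n. \<Union>i\<le>n. C i) = UNIV" by blast
  moreover have "compact (\<Union>i\<le>n. C i)" for n using C by (intro compact_UN) auto
  moreover have "(\<Union>i\<le>n. C i) \<subseteq> (\<Union>i\<le>k. C i)" if "n \<le> k" for n k using that by (intro UN_mono) auto
  ultimately show ?thesis by (intro that[of "\<lambda>n. \<Union>i\<le>n. C i"])
qed

lemma compact_borel: "compact (K :: 'a set) \<Longrightarrow> K \<in> sets borel"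
  by (intro borel_closed compact_imp_closed)

end

sublocale haar_group \<subseteq> sigma_finite_measure m
proof
  obtain K where K: "\<And>n::nat. compact (K n :: 'a set)" "(\<Union>n. K n) = UNIV"
    using compact_exhaustion by metis
  show "\<exists>A. countable A \<and> A \<subseteq> sets m \<and> \<Union>A = space m \<and> (\<forall>a\<in>A. emeasure m a \<noteq> \<infinity>)"
    by (rule exI[of _ "range K"])
       (use K emeasure_compact in \<open>auto simp: less_top[symmetric] intro: compact_borel\<close>)
qed

sublocale haar_group \<subseteq> pair_sigma_finite m m ..

context haar_group
begin

lemma outer_regular:
  assumes "A \<in> sets borel" "emeasure m A < \<infinity>" "0 < \<epsilon>"
  obtains U where "open U" "A \<subseteq> U" "emeasure m (U - A) < ennreal \<epsilon>" "emeasure m U < \<infinity>"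
proof -
  have inf: "emeasure m A = (INF U\<in>{U. open U \<and> A \<subseteq> U}. emeasure m U)"
  proof -
    have "\<forall>A\<in>sets m. emeasure m A = (INF U\<in>{U. open U \<and> A \<subseteq> U}. emeasure m U)"
      using haar unfolding left_haar_measure_def radon_measure_def by (elim conjE)
    moreover have "A \<in> sets m" using assms(1) by simp
    ultimately show ?thesis by (rule bspec)
  qed
  have lt: "emeasure m A < emeasure m A + ennreal \<epsilon>"
    using assms by (simp add: ennreal_add_left_cancel_less)
  then obtain U where U: "open U" "A \<subseteq> U" "emeasure m U < emeasure m A + ennreal \<epsilon>"
    using lt[unfolded inf] unfolding INF_less_iff inf by blast
  have "emeasure m U < \<infinity>" using U(3) assms(2)
    by (metis ennreal_add_less_top ennreal_less_top infinity_ennreal_def order.strict_trans)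
  moreover have "emeasure m (U - A) = emeasure m U - emeasure m A"
    using U assms by (intro emeasure_Diff) auto
  moreover have "emeasure m U - emeasure m A < ennreal \<epsilon>"
    using U assms by (metis add_diff_self_ennreal add_left_mono emeasure_mono sets_haar borel_open not_le)
  ultimately show ?thesis using U that by simp
qed

lemma inner_regular_open:
  assumes "open U" "emeasure m U < \<infinity>" "0 < \<epsilon>"
  obtains K where "compact K" "K \<subseteq> U" "emeasure m (U - K) < ennreal \<epsilon>"
proof (cases "emeasure m U = 0")
  case True
  then show ?thesis using assms by (intro that[of "{}"]) auto
next
  case False
  have sup: "emeasure m U = (SUP K\<in>{K. compact K \<and> K \<subseteq> U}. emeasure m K)"
  proof -
    have "\<forall>U. open U \<longrightarrow> emeasure m U = (SUP K\<in>{K. compact K \<and> K \<subseteq> U}. emeasure m K)"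
      using haar unfolding left_haar_measure_def radon_measure_def by (elim conjE)
    then show ?thesis using assms(1) by (elim allE impE)
  qed
  have "emeasure m U - ennreal \<epsilon> < emeasure m U"
    using False assms by (intro ennreal_between) (auto simp: zero_less_iff_neq_zero)
  then obtain K where K: "compact K" "K \<subseteq> U" "emeasure m U - ennreal \<epsilon> < emeasure m K"
    using sup by (metis (mono_tags, lifting) less_SUP_iff mem_Collect_eq)
  have lt: "emeasure m U < emeasure m K + ennreal \<epsilon>"
  proof (cases "ennreal \<epsilon> \<le> emeasure m U")
    case True
    then show ?thesis using K(3) by (simp add: minus_less_iff_ennreal)
  next
    case False
    then show ?thesis by (meson add_increasing le_less_trans less_le_trans not_le order_refl zero_le)
  qed
  have KU: "emeasure m (U - K) = emeasure m U - emeasure m K"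
    using K assms emeasure_compact[OF K(1)] by (intro emeasure_Diff) (auto intro: compact_borel)
  have "emeasure m U - emeasure m K < ennreal \<epsilon>"
    using lt K assms by (metis add_diff_self_ennreal add_left_mono emeasure_mono sets_haar borel_open not_le)
  then show ?thesis using K KU that by simp
qed

text \<open>
  Countably many translates of \<open>U\<close>, by the elements of a dense set, cover the group; if \<open>U\<close> were null,
  so would be the group.
\<close>

lemma emeasure_open_pos:
  assumes "open U" "U \<noteq> {}" shows "emeasure m U \<noteq> 0"
proof
  assume z: "emeasure m U = 0"
  obtain D :: "'a set" where D: "countable D" "\<And>X. open X \<Longrightarrow> X \<noteq> {} \<Longrightarrow> \<exists>d\<in>D. d \<in> X"
    using countable_dense_setE by metis
  have cover: "(\<Union>d\<in>D. (+) d ` U) = UNIV"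
  proof -
    have "\<exists>d\<in>D. x \<in> (+) d ` U" for x
    proof -
      have "open {d. - d + x \<in> U}"
        using continuous_on_open_vimage[of UNIV "\<lambda>d. - d + x"] assms(1)
        by (auto simp: vimage_def continuous_on_def intro!: tendsto_intros)
      moreover obtain u where "u \<in> U" using assms(2) by blast
      then have "x - u \<in> {d. - d + x \<in> U}" by simp
      ultimately obtain d where "d \<in> D" "- d + x \<in> U" using D(2)[of "{d. - d + x \<in> U}"] by blast
      then show ?thesis by (intro bexI[of _ d] image_eqI[of _ _ "- d + x"]) auto
    qed
    then show ?thesis by blast
  qed
  have "(\<Union>d\<in>D. (+) d ` U) \<in> null_sets m"
  proof (rule null_sets_UN'[OF D(1)])
    fix d
    have "(+) d ` U = (\<lambda>x. - d + x) -` U" by (auto simp: image_iff) (metis add_minus_cancel)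
    moreover have "open ((\<lambda>x. - d + x) -` U)"
      using assms by (intro open_vimage) (auto simp: continuous_on_def intro!: tendsto_intros)
    ultimately have "(+) d ` U \<in> sets borel" by simp
    then show "(+) d ` U \<in> null_sets m"
      using z emeasure_translate[of U d] assms by (auto simp: null_sets_def)
  qed
  then show False using haar by (simp add: cover null_sets_def left_haar_measure_def)
qed

lemma finite_measure_neighbourhood:
  obtains U :: "'a set" where "open U" "0 \<in> U" "emeasure m U < \<infinity>"
proof -
  obtain U C where "open U" "compact C" "0 \<in> U" "U \<subseteq> (C :: 'a set)"
    using locally_compact unfolding locally_compact_space_def by simp blast
  then show ?thesis
    using emeasure_compact[of C] emeasure_mono[of U C m] compact_borel[of C]
    by (intro that[of U]) (auto intro: le_less_trans)
qed

text \<open>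
  For the indicator of \<open>A\<close>, choose an open \<open>U \<supseteq> A\<close> and a compact \<open>K \<subseteq> U\<close> of nearly the same measure as
  \<open>A\<close> and \<open>U\<close> respectively.  For small \<open>t\<close> the translate of \<open>K\<close> stays inside \<open>U\<close> and
  fills most of it, which forces the translate of \<open>A\<close> to overlap with \<open>A\<close> up to small measure.
\<close>

lemma L1_strongly_continuous:
  fixes h :: "'a \<Rightarrow> real"
  assumes "integrable m h"
  shows "((\<lambda>t. LINT x|m. \<bar>h (t + x) - h x\<bar>) \<longlongrightarrow> 0) (nhds 0)"
  using assms
proof (induction rule: integrable_induct)
  case (base A c)
  have A: "A \<in> sets borel" "emeasure m A < \<infinity>" using base by auto
  have "((\<lambda>t. LINT x|m. \<bar>indicator A (t + x) - indicator A x\<bar> :: real) \<longlongrightarrow> 0) (nhds 0)"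
  proof (rule tendstoI)
    fix \<epsilon> :: real assume "0 < \<epsilon>"
    \<comment> \<open>Four errors of at most \<open>\<epsilon> / 5\<close> will occur, so their total stays strictly below \<open>\<epsilon>\<close>.\<close>
    then have e5: "0 < \<epsilon> / 5" by simp
    obtain U where U: "open U" "A \<subseteq> U" "emeasure m (U - A) < ennreal (\<epsilon> / 5)" "emeasure m U < \<infinity>"
      using outer_regular[OF A e5] .
    obtain K where K: "compact K" "K \<subseteq> U" "emeasure m (U - K) < ennreal (\<epsilon> / 5)"
      using inner_regular_open[OF U(1,4) e5] .
    have KB: "K \<in> sets borel" using K compact_borel by blast
    have Kfin: "emeasure m K < \<infinity>" using K emeasure_compact by blast
    define I where "I S = (indicator S :: 'a \<Rightarrow> real)" for S
    have int: "integrable m (I A)" "integrable m (I U)" "integrable m (I K)"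
      using A U KB Kfin by (auto simp: I_def less_top)
    have diff: "(LINT x|m. I U x - I S x) \<le> \<epsilon> / 5"
      if "S \<subseteq> U" "S \<in> sets borel" "emeasure m (U - S) < ennreal (\<epsilon> / 5)" for S
    proof -
      have "I U x - I S x = I (U - S) x" for x using that(1) by (auto simp: I_def indicator_def)
      then have "(LINT x|m. I U x - I S x) = measure m (U - S)" by (simp add: I_def)
      also have "\<dots> \<le> \<epsilon> / 5"
        unfolding measure_def using that(3) e5 by (intro enn2real_leI) auto
      finally show ?thesis .
    qed
    have "\<forall>\<^sub>F t in nhds 0. \<forall>k\<in>K. t + k \<in> U"
      by (rule compact_subset_open_translates[OF K(1) U(1) K(2)])
    then have "\<forall>\<^sub>F t in nhds (- 0). \<forall>k\<in>K. t + k \<in> U" by simp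
    then have "\<forall>\<^sub>F t in nhds 0. \<forall>k\<in>K. - t + k \<in> U"
      using tendsto_uminus_nhds[of "0::'a"] by (rule eventually_compose_filterlim)
    then show "\<forall>\<^sub>F t in nhds 0. dist (LINT x|m. \<bar>indicator A (t + x) - indicator A x\<bar> :: real) 0 < \<epsilon>"
    proof eventually_elim
      case (elim t)
      have KtU: "x \<in> U" if "t + x \<in> K" for x
        using elim that by (metis minus_add_cancel)
      note it = int[THEN integrable_translate[where s=t]]
      have "(LINT x|m. \<bar>I A (t + x) - I A x\<bar>)
          \<le> (LINT x|m. (I U (t + x) - I A (t + x)) + (I U (t + x) - I K (t + x))
               + (I U x - I K (t + x)) + (I U x - I A x))"
      proof (rule integral_mono)
        fix x
        show "\<bar>I A (t + x) - I A x\<bar> \<le> (I U (t + x) - I A (t + x)) + (I U (t + x) - I K (t + x))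
               + (I U x - I K (t + x)) + (I U x - I A x)"
          using U(2) K(2) KtU[of x] by (auto simp: I_def indicator_def)
      qed (use int it in auto)
      also have "\<dots> = (LINT x|m. I U (t + x) - I A (t + x)) + (LINT x|m. I U (t + x) - I K (t + x))
               + ((LINT x|m. I U x) - (LINT x|m. I K (t + x))) + (LINT x|m. I U x - I A x)"
        using int it by simp
      also have "\<dots> = (LINT x|m. I U x - I A x) + (LINT x|m. I U x - I K x)
               + (LINT x|m. I U x - I K x) + (LINT x|m. I U x - I A x)"
        using int integral_translate[of "\<lambda>x. I U x - I A x" t] integral_translate[of "\<lambda>x. I U x - I K x" t]
        by (simp add: integral_translate borel_measurable_integrable)
      also have "\<dots> \<le> \<epsilon> / 5 + \<epsilon> / 5 + \<epsilon> / 5 + \<epsilon> / 5"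
        by (intro add_mono diff) (use U K A KB in auto)
      also have "\<dots> < \<epsilon>" using \<open>0 < \<epsilon>\<close> by simp
      finally show ?case by (simp add: I_def)
    qed
  qed
  then have "((\<lambda>t. \<bar>c\<bar> * (LINT x|m. \<bar>indicator A (t + x) - indicator A x\<bar>)) \<longlongrightarrow> 0) (nhds 0)"
    by (rule tendsto_mult_right_zero)
  moreover have "\<bar>indicator A (t + x) *\<^sub>R c - indicator A x *\<^sub>R c\<bar>
      = \<bar>c\<bar> * \<bar>indicator A (t + x) - indicator A x\<bar>" for t x
    by (simp add: left_diff_distrib[symmetric] abs_mult)
  ultimately show ?case by simp
next
  case (add f g)
  note int = add.hyps add.hyps[THEN integrable_translate]
  show ?case
  proof (rule tendsto_sandwich[OF _ _ tendsto_const])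
    show "((\<lambda>t. (LINT x|m. \<bar>f (t + x) - f x\<bar>) + (LINT x|m. \<bar>g (t + x) - g x\<bar>)) \<longlongrightarrow> 0) (nhds 0)"
      using tendsto_add[OF add.IH] by simp
    show "\<forall>\<^sub>F t in nhds 0. (LINT x|m. \<bar>f (t + x) + g (t + x) - (f x + g x)\<bar>)
        \<le> (LINT x|m. \<bar>f (t + x) - f x\<bar>) + (LINT x|m. \<bar>g (t + x) - g x\<bar>)"
      using int by (intro always_eventually allI)
        (subst Bochner_Integration.integral_add[symmetric]; (intro integral_mono)?; auto)
  qed simp
next
  case (lim f s)
  have conv: "(\<lambda>i. LINT x|m. \<bar>s i x - f x\<bar>) \<longlonglongrightarrow> (LINT x|m. 0)"
  proof (rule integral_dominated_convergence[where w="\<lambda>x. 3 * \<bar>f x\<bar>"])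
    show "AE x in m. norm \<bar>s i x - f x\<bar> \<le> 3 * \<bar>f x\<bar>" for i
    proof (rule AE_I2)
      fix x
      have "\<bar>s i x\<bar> \<le> 2 * \<bar>f x\<bar>" using lim.hyps(3)[of x i] by simp
      then show "norm \<bar>s i x - f x\<bar> \<le> 3 * \<bar>f x\<bar>" by simp
    qed
    show "AE x in m. (\<lambda>i. \<bar>s i x - f x\<bar>) \<longlonglongrightarrow> 0"
    proof (rule AE_I2)
      fix x
      have "(\<lambda>i. s i x - f x) \<longlonglongrightarrow> f x - f x" using lim.hyps(2)[of x] by (intro tendsto_intros) auto
      then show "(\<lambda>i. \<bar>s i x - f x\<bar>) \<longlonglongrightarrow> 0" by (simp add: tendsto_rabs_zero_iff)
    qed
  qed (use lim.hyps in auto)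
  show ?case
  proof (rule tendstoI)
    fix \<epsilon> :: real assume "0 < \<epsilon>"
    then obtain i where i: "(LINT x|m. \<bar>s i x - f x\<bar>) < \<epsilon> / 3"
      using LIMSEQ_D[OF conv, of "\<epsilon> / 3"] by force
    have "\<forall>\<^sub>F t in nhds 0. dist (LINT x|m. \<bar>s i (t + x) - s i x\<bar>) 0 < \<epsilon> / 3"
      using lim.IH[of i] \<open>0 < \<epsilon>\<close> by (intro tendstoD) auto
    then show "\<forall>\<^sub>F t in nhds 0. dist (LINT x|m. \<bar>f (t + x) - f x\<bar>) 0 < \<epsilon>"
    proof eventually_elim
      case (elim t)
      note int = lim.hyps(1)[of i] lim.hyps(4) lim.hyps(1)[of i, THEN integrable_translate, of t]
        lim.hyps(4)[THEN integrable_translate, of t]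
      have "(LINT x|m. \<bar>f (t + x) - f x\<bar>)
         \<le> (LINT x|m. \<bar>s i (t + x) - f (t + x)\<bar> + \<bar>s i (t + x) - s i x\<bar> + \<bar>s i x - f x\<bar>)"
        using int by (intro integral_mono) auto
      also have "\<dots> = (LINT x|m. \<bar>s i (t + x) - f (t + x)\<bar>) + (LINT x|m. \<bar>s i (t + x) - s i x\<bar>)
          + (LINT x|m. \<bar>s i x - f x\<bar>)"
        using int by simp
      also have "(LINT x|m. \<bar>s i (t + x) - f (t + x)\<bar>) = (LINT x|m. \<bar>s i x - f x\<bar>)"
        using int by (intro integral_translate[where f="\<lambda>x. \<bar>s i x - f x\<bar>"]) auto
      finally show ?case using i elim by simp
    qed
  qed
qed

text \<open>
  The inequality \<open>\<bar>a - b\<bar>\<^sup>2 \<le> \<bar>a\<^sup>2 - b\<^sup>2\<bar>\<close> for nonnegative numbers reduces nonnegative functions to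
  the continuity of translations on \<open>L\<^sup>1\<close>; a complex function is a combination of four nonnegative ones.
\<close>

lemma L2_strongly_continuous:
  assumes "f \<in> L2 m"
  shows "((\<lambda>t. L2_norm m (\<lambda>x. f (t + x) - f x)) \<longlongrightarrow> 0) (nhds 0)"
proof -
  define C where "C f \<longleftrightarrow> f \<in> L2 m \<and> ((\<lambda>t. L2_norm m (\<lambda>x. f (t + x) - f x)) \<longlongrightarrow> 0) (nhds 0)" for f
  have add: "C (\<lambda>x. f x + g x)" if "C f" "C g" for f g
  proof -
    have L: "f \<in> L2 m" "g \<in> L2 m" using that by (auto simp: C_def)
    have "((\<lambda>t. L2_norm m (\<lambda>x. f (t + x) + g (t + x) - (f x + g x))) \<longlongrightarrow> 0) (nhds 0)"
    proof (rule tendsto_sandwich[OF _ _ tendsto_const])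
      show "((\<lambda>t. L2_norm m (\<lambda>x. f (t + x) - f x) + L2_norm m (\<lambda>x. g (t + x) - g x)) \<longlongrightarrow> 0) (nhds 0)"
        using that tendsto_add[of _ 0 "nhds 0" _ 0] unfolding C_def by fastforce
      show "\<forall>\<^sub>F t in nhds 0. L2_norm m (\<lambda>x. f (t + x) + g (t + x) - (f x + g x))
        \<le> L2_norm m (\<lambda>x. f (t + x) - f x) + L2_norm m (\<lambda>x. g (t + x) - g x)"
        using L2_triangle[OF L2_diff[OF L2_translate(1)[OF L(1)] L(1)] L2_diff[OF L2_translate(1)[OF L(2)] L(2)]]
        by (intro always_eventually allI) (simp add: algebra_simps)
    qed (simp add: L2_norm_nonneg)
    then show ?thesis using L by (simp add: C_def L2_add)
  qed
  have scale: "C (\<lambda>x. c * f x)" if "C f" for f c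
  proof -
    have "L2_norm m (\<lambda>x. c * f (t + x) - c * f x) = cmod c * L2_norm m (\<lambda>x. f (t + x) - f x)" for t
      by (subst L2_norm_scale[symmetric]) (simp add: right_diff_distrib)
    then show ?thesis
      using that by (simp add: C_def L2_scale tendsto_mult_right_zero)
  qed
  have pos: "C (\<lambda>x. of_real (h x))" if h: "h \<in> borel_measurable m" "\<And>x. 0 \<le> h x" "\<And>x. h x \<le> cmod (f x)" for h
  proof -
    have hL: "(\<lambda>x. of_real (h x)) \<in> L2 m"
      using h by (intro L2_dominated(1)[OF assms]) auto
    then have int: "integrable m (\<lambda>x. (h x)\<^sup>2)" by (simp add: L2_def)
    have "((\<lambda>t. sqrt (LINT x|m. \<bar>(h (t + x))\<^sup>2 - (h x)\<^sup>2\<bar>)) \<longlongrightarrow> sqrt 0) (nhds 0)"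
      by (intro tendsto_real_sqrt L1_strongly_continuous int)
    then have lim: "((\<lambda>t. sqrt (LINT x|m. \<bar>(h (t + x))\<^sup>2 - (h x)\<^sup>2\<bar>)) \<longlongrightarrow> 0) (nhds 0)" by simp
    have "((\<lambda>t. L2_norm m (\<lambda>x. complex_of_real (h (t + x)) - of_real (h x))) \<longlongrightarrow> 0) (nhds 0)"
    proof (rule tendsto_sandwich[OF _ _ tendsto_const lim])
      have "L2_norm m (\<lambda>x. complex_of_real (h (t + x)) - of_real (h x)) \<le> sqrt (LINT x|m. \<bar>(h (t + x))\<^sup>2 - (h x)\<^sup>2\<bar>)" for t
        unfolding L2_norm_def
      proof (intro real_sqrt_le_mono integral_mono)
        show "integrable m (\<lambda>x. (cmod (complex_of_real (h (t + x)) - complex_of_real (h x)))\<^sup>2)"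
          by (rule L2_integrable[OF L2_diff[OF L2_translate(1)[OF hL] hL]])
        show "integrable m (\<lambda>x. \<bar>(h (t + x))\<^sup>2 - (h x)\<^sup>2\<bar>)"
          using int integrable_translate[OF int] by auto
        fix x
        have "(h (t + x) - h x)\<^sup>2 \<le> \<bar>h (t + x) - h x\<bar> * \<bar>h (t + x) + h x\<bar>"
          unfolding power2_abs[of "h (t + x) - h x", symmetric] power2_eq_square[of "\<bar>_\<bar>"]
          using h(2)[of x] h(2)[of "t + x"] by (intro mult_left_mono) auto
        also have "\<dots> = \<bar>(h (t + x))\<^sup>2 - (h x)\<^sup>2\<bar>"
          by (simp add: abs_mult[symmetric] power2_eq_square algebra_simps)
        finally show "(cmod (complex_of_real (h (t + x)) - complex_of_real (h x)))\<^sup>2 \<le> \<bar>(h (t + x))\<^sup>2 - (h x)\<^sup>2\<bar>"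
          by (simp flip: of_real_diff)
      qed
      then show "\<forall>\<^sub>F t in nhds 0. L2_norm m (\<lambda>x. complex_of_real (h (t + x)) - of_real (h x))
          \<le> sqrt (LINT x|m. \<bar>(h (t + x))\<^sup>2 - (h x)\<^sup>2\<bar>)" by simp
    qed (simp add: L2_norm_nonneg)
    then show ?thesis using hL by (simp add: C_def)
  qed
  note [measurable] = L2_measurable[OF assms]
  define p1 p2 p3 p4 where "p1 x = max 0 (Re (f x))" and "p2 x = max 0 (- Re (f x))"
    and "p3 x = max 0 (Im (f x))" and "p4 x = max 0 (- Im (f x))" for x
  have P: "C (\<lambda>x. of_real (p1 x))" "C (\<lambda>x. of_real (p2 x))" "C (\<lambda>x. of_real (p3 x))" "C (\<lambda>x. of_real (p4 x))"
    using abs_Re_le_cmod abs_Im_le_cmod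
    by (intro pos; force simp: p1_def p2_def p3_def p4_def abs_le_iff)+
  have "C (\<lambda>x. (of_real (p1 x) + (-1) * of_real (p2 x)) + \<i> * (of_real (p3 x) + (-1) * of_real (p4 x)))"
    by (intro add scale P)
  also have "(\<lambda>x. (of_real (p1 x) + (-1) * of_real (p2 x)) + \<i> * (of_real (p3 x) + (-1) * of_real (p4 x))) = f"
    by (rule ext, rule complex_eqI) (auto simp: p1_def p2_def p3_def p4_def max_def)
  finally show ?thesis by (simp add: C_def)
qed

end


section \<open>Series of coefficient functions\<close>

lemma sums_interleave:
  fixes f g :: "nat \<Rightarrow> 'b::real_normed_vector"
  assumes "f sums a" "g sums b"
  shows "(\<lambda>n. if even n then f (n div 2) else g (n div 2)) sums (a + b)"
proof -
  have "(if even n then f (n div 2) else 0) = 0" if "n \<notin> range (\<lambda>n. 2 * n)" for n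
    using that by (auto simp: image_iff dvd_def)
  then have "(\<lambda>n. if even n then f (n div 2) else 0) sums a"
    using sums_mono_reindex[of "\<lambda>n. 2 * n" "\<lambda>n. if even n then f (n div 2) else 0" a] assms(1)
    by (auto simp: strict_mono_def)
  moreover have "(if even n then 0 else g (n div 2)) = 0" if "n \<notin> range (\<lambda>n. 2 * n + 1)" for n
    using that by (auto simp: image_iff elim!: oddE)
  then have "(\<lambda>n. if even n then 0 else g (n div 2)) sums b"
    using sums_mono_reindex[of "\<lambda>n. 2 * n + 1" "\<lambda>n. if even n then 0 else g (n div 2)" b] assms(2)
    by (auto simp: strict_mono_def elim!: oddE)
  ultimately have "(\<lambda>n. (if even n then f (n div 2) else 0) + (if even n then 0 else g (n div 2))) sums (a + b)"
    by (rule sums_add)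
  moreover have "(\<lambda>n. (if even n then f (n div 2) else 0) + (if even n then 0 else g (n div 2)))
      = (\<lambda>n. if even n then f (n div 2) else g (n div 2))" by auto
  ultimately show ?thesis by simp
qed

text \<open>
  The sequences of elementary tensors that define an element of \<open>T(G)\<close>, and also those that are admitted
  in the definition of \<open>fourier_norm\<close>.
\<close>

definition L2_pairs :: "'a measure \<Rightarrow> (nat \<Rightarrow> 'a \<Rightarrow> complex) \<Rightarrow> (nat \<Rightarrow> 'a \<Rightarrow> complex) \<Rightarrow> bool" where
  "L2_pairs m f g \<longleftrightarrow> (\<forall>n. f n \<in> L2 m \<and> g n \<in> L2 m) \<and> summable (\<lambda>n. L2_norm m (f n) * L2_norm m (g n))"

lemma L2_pairsD:
  assumes "L2_pairs m f g"
  shows "f n \<in> L2 m" "g n \<in> L2 m" "summable (\<lambda>n. L2_norm m (f n) * L2_norm m (g n))"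
  using assms by (auto simp: L2_pairs_def)

lemma L2_pairs_dominated:
  assumes "L2_pairs m f g" "\<And>n. f' n \<in> L2 m" "\<And>n. g' n \<in> L2 m"
    "\<And>n. L2_norm m (f' n) \<le> L2_norm m (f n)" "\<And>n. L2_norm m (g' n) \<le> L2_norm m (g n)"
  shows "L2_pairs m f' g'"
  unfolding L2_pairs_def
proof (intro conjI allI assms(2,3) summable_comparison_test'[OF L2_pairsD(3)[OF assms(1)]])
  show "norm (L2_norm m (f' n) * L2_norm m (g' n)) \<le> L2_norm m (f n) * L2_norm m (g n)" for n
    using assms(4,5)[of n] by (auto intro!: mult_mono simp: L2_norm_nonneg)
qed

lemma L2_pairs_interleave:
  assumes "L2_pairs m f g" "L2_pairs m f' g'"
  shows "L2_pairs m (\<lambda>n. if even n then f (n div 2) else f' (n div 2)) (\<lambda>n. if even n then g (n div 2) else g' (n div 2))"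
    and "(\<Sum>n. L2_norm m (if even n then f (n div 2) else f' (n div 2)) * L2_norm m (if even n then g (n div 2) else g' (n div 2)))
        = (\<Sum>n. L2_norm m (f n) * L2_norm m (g n)) + (\<Sum>n. L2_norm m (f' n) * L2_norm m (g' n))"
proof -
  have "(\<lambda>n. if even n then L2_norm m (f (n div 2)) * L2_norm m (g (n div 2)) else L2_norm m (f' (n div 2)) * L2_norm m (g' (n div 2)))
      sums ((\<Sum>n. L2_norm m (f n) * L2_norm m (g n)) + (\<Sum>n. L2_norm m (f' n) * L2_norm m (g' n)))"
    by (intro sums_interleave summable_sums L2_pairsD(3) assms)
  moreover have "(\<lambda>n. if even n then L2_norm m (f (n div 2)) * L2_norm m (g (n div 2)) else L2_norm m (f' (n div 2)) * L2_norm m (g' (n div 2)))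
    = (\<lambda>n. L2_norm m (if even n then f (n div 2) else f' (n div 2)) * L2_norm m (if even n then g (n div 2) else g' (n div 2)))"
    by auto
  ultimately have *: "(\<lambda>n. L2_norm m (if even n then f (n div 2) else f' (n div 2)) * L2_norm m (if even n then g (n div 2) else g' (n div 2)))
      sums ((\<Sum>n. L2_norm m (f n) * L2_norm m (g n)) + (\<Sum>n. L2_norm m (f' n) * L2_norm m (g' n)))"
    by simp
  show "L2_pairs m (\<lambda>n. if even n then f (n div 2) else f' (n div 2)) (\<lambda>n. if even n then g (n div 2) else g' (n div 2))"
    using assms sums_summable[OF *] by (simp add: L2_pairs_def)
  show "(\<Sum>n. L2_norm m (if even n then f (n div 2) else f' (n div 2)) * L2_norm m (if even n then g (n div 2) else g' (n div 2)))
        = (\<Sum>n. L2_norm m (f n) * L2_norm m (g n)) + (\<Sum>n. L2_norm m (f' n) * L2_norm m (g' n))"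
    using * by (rule sums_unique[symmetric])
qed

lemma L2_pairs_series:
  assumes "L2_pairs m f g"
  shows "AE x in m. summable (\<lambda>n. cmod (f n x * g n x))"
    and "integrable m (\<lambda>x. \<Sum>n. f n x * g n x)"
    and "(\<lambda>n. LINT x|m. f n x * g n x) sums (LINT x|m. (\<Sum>n. f n x * g n x))"
proof -
  note L = L2_pairsD[OF assms]
  have int: "integrable m (\<lambda>x. f n x * g n x)" for n by (rule L2_mult_integrable[OF L(1,2)])
  then have [measurable]: "(\<lambda>x. f n x * g n x) \<in> borel_measurable m" for n by auto
  have sm: "summable (\<lambda>n. LINT x|m. cmod (f n x * g n x))"
    by (rule summable_comparison_test'[OF L(3)])
       (use L2_Cauchy_Schwarz[OF L(1,2)] in \<open>auto simp: integral_nonneg_AE\<close>)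
  have "(\<integral>\<^sup>+x. (\<Sum>n. ennreal (cmod (f n x * g n x))) \<partial>m) = (\<Sum>n. \<integral>\<^sup>+x. ennreal (cmod (f n x * g n x)) \<partial>m)"
    by (rule nn_integral_suminf) measurable
  also have "\<dots> = (\<Sum>n. ennreal (LINT x|m. cmod (f n x * g n x)))"
    by (intro suminf_cong nn_integral_eq_integral integrable_norm int) auto
  also have "\<dots> \<noteq> \<infinity>" using sm by (simp add: ennreal_suminf_neq_top integral_nonneg_AE)
  finally have "AE x in m. (\<Sum>n. ennreal (cmod (f n x * g n x))) \<noteq> \<infinity>"
    by (intro nn_integral_PInf_AE) measurable
  then show AE: "AE x in m. summable (\<lambda>n. cmod (f n x * g n x))"
    by eventually_elim (auto intro!: summable_suminf_not_top)
  show "integrable m (\<lambda>x. \<Sum>n. f n x * g n x)" by (rule integrable_suminf[OF int AE sm])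
  show "(\<lambda>n. LINT x|m. f n x * g n x) sums (LINT x|m. (\<Sum>n. f n x * g n x))"
    by (rule sums_integral[OF int AE sm])
qed

text \<open>
  The number \<open>c\<close> is the value that the series contributes to the infimum \<open>fourier_norm\<close>.
\<close>

definition coefficient_series :: "'a::group_add measure \<Rightarrow> ('a \<Rightarrow> complex) \<Rightarrow> real \<Rightarrow> bool" where
  "coefficient_series m u c \<longleftrightarrow>
     (\<exists>\<xi> \<eta>. L2_pairs m \<xi> \<eta> \<and> (\<forall>s. (\<lambda>n. coefficient m (\<xi> n) (\<eta> n) s) sums u s) \<and>
        (\<Sum>n. L2_norm m (\<xi> n) * L2_norm m (\<eta> n)) = c)"

lemma fourier_norm_le:
  assumes "coefficient_series m u c" shows "fourier_norm m u \<le> c"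
proof -
  obtain \<xi> \<eta> where "L2_pairs m \<xi> \<eta>" "\<And>s. (\<lambda>n. coefficient m (\<xi> n) (\<eta> n) s) sums u s"
    "(\<Sum>n. L2_norm m (\<xi> n) * L2_norm m (\<eta> n)) = c"
    using assms by (auto simp: coefficient_series_def)
  then show ?thesis
    unfolding fourier_norm_def
    by (intro cInf_lower bdd_belowI[where m=0]; force simp: L2_pairs_def L2_norm_nonneg intro!: suminf_nonneg)
qed

lemma coefficient_series_add:
  assumes "coefficient_series m u c" "coefficient_series m v d"
  shows "coefficient_series m (\<lambda>s. u s + v s) (c + d)"
proof -
  obtain \<xi> \<eta> where 1: "L2_pairs m \<xi> \<eta>" "\<And>s. (\<lambda>n. coefficient m (\<xi> n) (\<eta> n) s) sums u s"
    "(\<Sum>n. L2_norm m (\<xi> n) * L2_norm m (\<eta> n)) = c"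
    using assms(1) by (auto simp: coefficient_series_def)
  obtain \<xi>' \<eta>' where 2: "L2_pairs m \<xi>' \<eta>'" "\<And>s. (\<lambda>n. coefficient m (\<xi>' n) (\<eta>' n) s) sums v s"
    "(\<Sum>n. L2_norm m (\<xi>' n) * L2_norm m (\<eta>' n)) = d"
    using assms(2) by (auto simp: coefficient_series_def)
  have "(\<lambda>n. coefficient m (if even n then \<xi> (n div 2) else \<xi>' (n div 2)) (if even n then \<eta> (n div 2) else \<eta>' (n div 2)) s)
      = (\<lambda>n. if even n then coefficient m (\<xi> (n div 2)) (\<eta> (n div 2)) s else coefficient m (\<xi>' (n div 2)) (\<eta>' (n div 2)) s)" for s
    by auto
  then have "(\<lambda>n. coefficient m (if even n then \<xi> (n div 2) else \<xi>' (n div 2)) (if even n then \<eta> (n div 2) else \<eta>' (n div 2)) s) sums (u s + v s)" for s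
    using sums_interleave[OF 1(2) 2(2)] by simp
  then show ?thesis
    unfolding coefficient_series_def using L2_pairs_interleave[OF 1(1) 2(1)] 1(3) 2(3) by blast
qed


section \<open>Marginally null sets and the projective tensor square\<close>

lemma marginally_null_subset: "marginally_null m T \<Longrightarrow> S \<subseteq> T \<Longrightarrow> marginally_null m S"
  unfolding marginally_null_def by (meson order_trans)

lemma marginally_null_Un:
  assumes "marginally_null m S" "marginally_null m T" shows "marginally_null m (S \<union> T)"
proof -
  obtain M N M' N' where "M \<in> null_sets m" "N \<in> null_sets m" "S \<subseteq> (M \<times> UNIV) \<union> (UNIV \<times> N)"
    "M' \<in> null_sets m" "N' \<in> null_sets m" "T \<subseteq> (M' \<times> UNIV) \<union> (UNIV \<times> N')"
    using assms unfolding marginally_null_def by blast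
  then show ?thesis unfolding marginally_null_def
    by (intro bexI[of _ "M \<union> M'"] bexI[of _ "N \<union> N'"]) auto
qed

lemma marginally_null_empty: "marginally_null m {}"
  unfolding marginally_null_def by (intro bexI[of _ "{}"]) auto

lemma representsD:
  assumes "represents m f g w"
  shows "L2_pairs m f g" "marginally_null m {(x, y). \<not> (\<lambda>n. f n x * g n y) sums w (x, y)}"
  using assms by (auto simp: represents_def L2_pairs_def)

lemma represents_diff:
  assumes "represents m f g w" "represents m f' g' w'"
  shows "\<exists>f'' g''. represents m f'' g'' (\<lambda>p. w p - w' p)"
proof -
  define f'' where "f'' = (\<lambda>n. if even n then f (n div 2) else (\<lambda>x. (- 1) * f' (n div 2) x))"
  define g'' where "g'' = (\<lambda>n. if even n then g (n div 2) else g' (n div 2))"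
  note 1 = representsD[OF assms(1)] and 2 = representsD[OF assms(2)]
  have neg: "L2_pairs m (\<lambda>n x. (- 1) * f' n x) g'"
    by (rule L2_pairs_dominated[OF 2(1)])
       (use L2_pairsD[OF 2(1)] L2_scale[OF L2_pairsD(1)[OF 2(1)], of "-1"] L2_norm_scale[of m "-1"] in auto)
  have LP: "L2_pairs m f'' g''"
    unfolding f''_def g''_def by (rule L2_pairs_interleave(1)[OF 1(1) neg])
  have "{(x, y). \<not> (\<lambda>n. f'' n x * g'' n y) sums (w (x, y) - w' (x, y))}
      \<subseteq> {(x, y). \<not> (\<lambda>n. f n x * g n y) sums w (x, y)} \<union> {(x, y). \<not> (\<lambda>n. f' n x * g' n y) sums w' (x, y)}"
  proof clarify
    fix x y assume n: "\<not> (\<lambda>n. f'' n x * g'' n y) sums (w (x, y) - w' (x, y))" and b: "(\<lambda>n. f' n x * g' n y) sums w' (x, y)"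
    show "(\<lambda>n. f n x * g n y) sums w (x, y) \<Longrightarrow> False"
    proof -
      assume a: "(\<lambda>n. f n x * g n y) sums w (x, y)"
      have "(\<lambda>n. f'' n x * g'' n y) = (\<lambda>n. if even n then f (n div 2) x * g (n div 2) y else - (f' (n div 2) x * g' (n div 2) y))"
        by (auto simp: f''_def g''_def)
      then show False using sums_interleave[OF a sums_minus[OF b]] n by simp
    qed
  qed
  then have "marginally_null m {(x, y). \<not> (\<lambda>n. f'' n x * g'' n y) sums (w (x, y) - w' (x, y))}"
    using marginally_null_Un[OF 1(2) 2(2)] by (rule marginally_null_subset[rotated])
  with LP show ?thesis unfolding represents_def L2_pairs_def by blast
qed

lemma T_norm_lessD:
  assumes "represents m f0 g0 w" "T_norm m w < c"
  obtains f g where "represents m f g w" "(\<Sum>n. L2_norm m (f n) * L2_norm m (g n)) < c"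
proof -
  have "{(\<Sum>n. L2_norm m (f n) * L2_norm m (g n)) |f g. represents m f g w} \<noteq> {}" using assms(1) by blast
  from cInf_lessD[OF this assms(2)[unfolded T_norm_def]] show ?thesis using that by blast
qed

lemma suminf_tendsto_zero:
  fixes a :: "nat \<Rightarrow> nat \<Rightarrow> real"
  assumes "\<And>n. (\<lambda>k. a n k) \<longlonglongrightarrow> 0" "\<And>n k. \<bar>a n k\<bar> \<le> b n" "summable b"
  shows "(\<lambda>k. \<Sum>n. a n k) \<longlonglongrightarrow> 0"
proof -
  have "\<forall>\<^sub>F (n, k) in at_top \<times>\<^sub>F sequentially. norm (a n k) \<le> b n"
    using assms(2) by (intro always_eventually) auto
  from tannerys_theorem[OF assms(1) this assms(3)] show ?thesis by simp
qed


section \<open>Fibre integrals\<close>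

context haar_group
begin

lemma coefficient_convolution:
  assumes "f \<in> L2 m" "g \<in> L2 m"
  shows "coefficient m g (\<lambda>x. cnj (f x)) s = (LINT y|m. f (s + y) * g y)"
proof -
  note [measurable] = L2_measurable[OF assms(1)] L2_measurable[OF assms(2)]
  have "coefficient m g (\<lambda>x. cnj (f x)) s = (LINT t|m. g (- s + t) * f t)"
    by (simp add: coefficient_def left_regular_def)
  also have "\<dots> = (LINT y|m. g (- s + (s + y)) * f (s + y))"
    by (rule integral_translate[symmetric]) measurable
  also have "\<dots> = (LINT y|m. f (s + y) * g y)"
    by (simp add: mult.commute)
  finally show ?thesis .
qed

text \<open>
  The map from \<open>T(G)\<close> to functions on \<open>G\<close>: integrate \<open>\<Sum> f\<^sub>n(x) g\<^sub>n(y)\<close> over the fibre \<open>x - y = s\<close>.  Its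
  argument is the representing sequence and not the represented function \<open>w\<close>, because \<open>w\<close> is only
  determined marginally almost everywhere and its restriction to a fibre can fail to be measurable.
\<close>

definition fibre_integral :: "(nat \<Rightarrow> 'a \<Rightarrow> complex) \<Rightarrow> (nat \<Rightarrow> 'a \<Rightarrow> complex) \<Rightarrow> 'a \<Rightarrow> complex" where
  "fibre_integral f g s = (LINT y|m. (\<Sum>n. f n (s + y) * g n y))"

lemma L2_pairs_translate:
  assumes "L2_pairs m f g" shows "L2_pairs m (\<lambda>n y. f n (s + y)) g"
  using assms by (auto simp: L2_pairs_def L2_translate)

lemma fibre_integral_sums:
  assumes "L2_pairs m f g"
  shows "(\<lambda>n. LINT y|m. f n (s + y) * g n y) sums fibre_integral f g s"
  unfolding fibre_integral_def by (rule L2_pairs_series(3)[OF L2_pairs_translate[OF assms]])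

lemma fibre_integral_coefficient_series:
  assumes "L2_pairs m f g"
  shows "coefficient_series m (fibre_integral f g) (\<Sum>n. L2_norm m (f n) * L2_norm m (g n))"
  unfolding coefficient_series_def
proof (intro exI conjI allI)
  show "L2_pairs m g (\<lambda>n x. cnj (f n x))"
    using assms by (auto simp: L2_pairs_def L2_norm_cnj L2_cnj mult.commute)
  show "(\<lambda>n. coefficient m (g n) (\<lambda>x. cnj (f n x)) s) sums fibre_integral f g s" for s
    using fibre_integral_sums[OF assms] L2_pairsD[OF assms] by (simp add: coefficient_convolution)
  show "(\<Sum>n. L2_norm m (g n) * L2_norm m (\<lambda>x. cnj (f n x))) = (\<Sum>n. L2_norm m (f n) * L2_norm m (g n))"
    by (simp add: L2_norm_cnj mult.commute)
qed

lemma fibre_integral_add: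
  assumes f: "L2_pairs m f g" and f1: "L2_pairs m f1 g1" and f2: "L2_pairs m f2 g2"
    and eq: "\<And>n x y. f n x * g n y = f1 n x * g1 n y + f2 n x * g2 n y"
  shows "fibre_integral f g s = fibre_integral f1 g1 s + fibre_integral f2 g2 s"
proof -
  have int: "integrable m (\<lambda>y. f n (s + y) * g n y)" if "L2_pairs m f g" for f g n
    using L2_pairsD[OF that] by (intro L2_mult_integrable L2_translate(1))
  have "(\<lambda>n. LINT y|m. f n (s + y) * g n y) = (\<lambda>n. (LINT y|m. f1 n (s + y) * g1 n y) + (LINT y|m. f2 n (s + y) * g2 n y))"
    unfolding eq using int[OF f1] int[OF f2] by simp
  then show ?thesis
    using fibre_integral_sums[OF f, of s] sums_add[OF fibre_integral_sums[OF f1, of s] fibre_integral_sums[OF f2, of s]]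
    by (simp add: sums_iff)
qed

text \<open>
  A fibre is the graph of a left translation, and left translations preserve null sets.
\<close>

lemma marginally_null_fibre:
  assumes "marginally_null m S" shows "AE y in m. (s + y, y) \<notin> S"
proof -
  obtain M N where MN: "M \<in> null_sets m" "N \<in> null_sets m" "S \<subseteq> (M \<times> UNIV) \<union> (UNIV \<times> N)"
    using assms unfolding marginally_null_def by blast
  have "AE y in m. s + y \<notin> M" by (rule AE_translate[OF AE_not_in[OF MN(1)]])
  moreover have "AE y in m. y \<notin> N" by (rule AE_not_in[OF MN(2)])
  ultimately show ?thesis by eventually_elim (use MN in auto)
qed

lemma represents_fibre:
  assumes "represents m f g w"
  shows "AE y in m. (\<lambda>n. f n (s + y) * g n y) sums w (s + y, y)"
  using marginally_null_fibre[OF representsD(2)[OF assms], of s] by simp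

text \<open>
  Representing series converge to the represented function almost everywhere on each fibre, so the
  fibre integral depends additively on the represented function alone.
\<close>

lemma fibre_integral_diff_represents:
  assumes "represents m f g w" "represents m f' g' w'" "represents m f'' g'' (\<lambda>p. w p - w' p)"
  shows "fibre_integral f'' g'' s = fibre_integral f g s - fibre_integral f' g' s"
proof -
  note int = assms[THEN representsD(1), THEN L2_pairs_translate[of _ _ s], THEN L2_pairs_series(2)]
  have "fibre_integral f'' g'' s = (LINT y|m. (\<Sum>n. f n (s + y) * g n y) - (\<Sum>n. f' n (s + y) * g' n y))"
    unfolding fibre_integral_def
  proof (rule integral_cong_AE)
    show "AE y in m. (\<Sum>n. f'' n (s + y) * g'' n y) = (\<Sum>n. f n (s + y) * g n y) - (\<Sum>n. f' n (s + y) * g' n y)"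
      using assms[THEN represents_fibre[where s=s]] by eventually_elim (simp add: sums_iff)
  qed (use int in auto)
  then show ?thesis using int by (simp add: fibre_integral_def)
qed


section \<open>Covers by measurable rectangles\<close>

text \<open>
  The open set \<open>U k n\<close> replaces \<open>A n\<close> inside \<open>K k\<close>.  The errors for fixed \<open>k\<close> are collected in a set \<open>Z k\<close> of
  measure at most \<open>2\<^sup>-\<^sup>k\<close>, so by Borel and Cantelli almost every point escapes them eventually.
\<close>

lemma outer_regular_family:
  fixes A K :: "nat \<Rightarrow> 'a set"
  assumes A: "\<And>n. A n \<in> sets borel" and K: "\<And>k. compact (K k)"
  obtains U :: "nat \<Rightarrow> nat \<Rightarrow> 'a set" and Z :: "nat \<Rightarrow> 'a set" where "\<And>k n. open (U k n)" "\<And>k n. A n \<inter> K k \<subseteq> U k n"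
    "\<And>k n. U k n - Z k \<subseteq> A n" "\<And>k. Z k \<in> sets borel" "AE x in m. \<forall>\<^sub>F k in sequentially. x \<notin> Z k"
proof -
  \<comment> \<open>For fixed \<open>k\<close> the tolerances add up to \<open>2\<^sup>-\<^sup>k\<close>, which is summable in \<open>k\<close>.\<close>
  define \<epsilon> :: "nat \<Rightarrow> nat \<Rightarrow> real" where "\<epsilon> k n = (1/2) ^ k * (1/2) ^ Suc n" for k n
  have AK: "A n \<inter> K k \<in> sets borel" for n k using A compact_borel[OF K] by auto
  have "\<exists>U. open U \<and> A n \<inter> K k \<subseteq> U \<and> emeasure m (U - (A n \<inter> K k)) < ennreal (\<epsilon> k n)" for k n
  proof -
    have "emeasure m (A n \<inter> K k) \<le> emeasure m (K k)"
      using compact_borel[OF K] by (intro emeasure_mono) auto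
    then have "emeasure m (A n \<inter> K k) < \<infinity>" using emeasure_compact[OF K, of k] by (rule le_less_trans)
    moreover have "0 < \<epsilon> k n" by (simp add: \<epsilon>_def)
    ultimately show ?thesis using outer_regular[OF AK] by metis
  qed
  moreover define U where "U k n =
    (SOME U. open U \<and> A n \<inter> K k \<subseteq> U \<and> emeasure m (U - (A n \<inter> K k)) < ennreal (\<epsilon> k n))" for k n
  ultimately have U: "open (U k n)" "A n \<inter> K k \<subseteq> U k n"
    "emeasure m (U k n - (A n \<inter> K k)) < ennreal (\<epsilon> k n)" for k n
    unfolding U_def by (metis (mono_tags, lifting) someI_ex)+
  define Z where "Z k = (\<Union>n. U k n - (A n \<inter> K k))" for k
  have Z: "Z k \<in> sets borel" for k unfolding Z_def using U(1) AK by auto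
  have mZ: "emeasure m (Z k) \<le> ennreal ((1/2) ^ k)" for k
  proof -
    have "emeasure m (Z k) \<le> (\<Sum>n. emeasure m (U k n - (A n \<inter> K k)))"
      unfolding Z_def using U(1) AK by (intro emeasure_subadditive_countably) auto
    also have "\<dots> \<le> (\<Sum>n. ennreal (\<epsilon> k n))"
      using U(3) by (intro suminf_le less_imp_le) auto
    also have "\<dots> = ennreal ((1/2) ^ k)"
    proof -
      have s: "(\<lambda>n. \<epsilon> k n) sums ((1/2) ^ k * 1)"
        unfolding \<epsilon>_def by (intro sums_mult power_half_series)
      have nn: "0 \<le> \<epsilon> k n" for n by (simp add: \<epsilon>_def)
      show ?thesis using suminf_ennreal_eq[OF nn s] by (simp only: mult_1_right)
    qed
    finally show ?thesis .
  qed
  have "AE x in m. \<forall>\<^sub>F k in sequentially. x \<in> space m - Z k"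
  proof (rule borel_cantelli_AE1)
    show "emeasure m (Z k) < \<infinity>" for k
      unfolding infinity_ennreal_def using mZ[of k] ennreal_less_top by (rule le_less_trans)
    show "summable (\<lambda>k. measure m (Z k))"
    proof (rule summable_comparison_test'[where g="\<lambda>k. (1/2 :: real) ^ k"])
      show "norm (measure m (Z k)) \<le> (1/2) ^ k" for k
        using mZ[of k] by (simp add: measure_def enn2real_leI)
    qed (simp add: summable_geometric)
  qed (use Z in simp)
  then have AE: "AE x in m. \<forall>\<^sub>F k in sequentially. x \<notin> Z k" by simp
  have UZ: "U k n - Z k \<subseteq> A n" for k n unfolding Z_def by blast
  show ?thesis by (rule that[OF U(1) U(2) UZ Z AE])
qed

text \<open>
  Compactness of \<open>K k \<times> K k\<close> does not apply to a cover by measurable rectangles.  It does after the sides are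
  enlarged to open sets, and deleting the exceptional sets of small measure from \<open>K k\<close>
  undoes the enlargement.
\<close>

lemma rectangle_cover_essentially_finite:
  fixes A B :: "nat \<Rightarrow> 'a set"
  assumes A: "\<And>n. A n \<in> sets borel" and B: "\<And>n. B n \<in> sets borel"
    and cover: "(\<Union>n. A n \<times> B n) = UNIV"
  obtains X Y K :: "nat \<Rightarrow> 'a set" and N :: "nat \<Rightarrow> nat"
  where "\<And>k. X k \<in> sets borel" "\<And>k. Y k \<in> sets borel" "\<And>k. compact (K k)" "\<And>k. X k \<subseteq> K k" "\<And>k. Y k \<subseteq> K k"
    "\<And>k. X k \<times> Y k \<subseteq> (\<Union>n<N k. A n \<times> B n)"
    "AE x in m. \<forall>\<^sub>F k in sequentially. x \<in> X k" "AE x in m. \<forall>\<^sub>F k in sequentially. x \<in> Y k"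
proof -
  obtain K :: "nat \<Rightarrow> 'a set" where K: "\<And>n. compact (K n)" "\<And>i j. i \<le> j \<Longrightarrow> K i \<subseteq> K j" "(\<Union>n. K n) = UNIV"
    using compact_exhaustion by blast
  have evK: "\<forall>\<^sub>F k in sequentially. x \<in> K k" for x
  proof -
    obtain i where "x \<in> K i" using K(3) by blast
    then show ?thesis using K(2) by (auto simp: eventually_sequentially)
  qed
  obtain U Z where U: "\<And>k n. open (U k n)" "\<And>k n. A n \<inter> K k \<subseteq> U k n"
    "\<And>k n. U k n - Z k \<subseteq> A n" "\<And>k. Z k \<in> sets borel" "AE x in m. \<forall>\<^sub>F k in sequentially. x \<notin> Z k"
    by (rule outer_regular_family[of A K, OF A K(1)], rule that, assumption+)
  obtain V W where V: "\<And>k n. open (V k n)" "\<And>k n. B n \<inter> K k \<subseteq> V k n"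
    "\<And>k n. V k n - W k \<subseteq> B n" "\<And>k. W k \<in> sets borel" "AE x in m. \<forall>\<^sub>F k in sequentially. x \<notin> W k"
    by (rule outer_regular_family[of B K, OF B K(1)], rule that, assumption+)
  have "\<exists>N. K k \<times> K k \<subseteq> (\<Union>n<N. U k n \<times> V k n)" for k
  proof -
    have "K k \<times> K k \<subseteq> (\<Union>n. U k n \<times> V k n)"
    proof
      fix p assume p: "p \<in> K k \<times> K k"
      have "p \<in> (\<Union>n. A n \<times> B n)" unfolding cover by simp
      then obtain n where "p \<in> A n \<times> B n" by blast
      then show "p \<in> (\<Union>n. U k n \<times> V k n)" using p U(2)[of n k] V(2)[of n k] by blast
    qed
    moreover have "compact (K k \<times> K k)" by (intro compact_Times K)
    ultimately obtain F where F: "finite F" "K k \<times> K k \<subseteq> (\<Union>n\<in>F. U k n \<times> V k n)"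
      by (elim compactE_image[of "K k \<times> K k" UNIV "\<lambda>n. U k n \<times> V k n"]) (auto intro: open_Times U(1) V(1))
    obtain N where "\<forall>n\<in>F. n < N" using finite_nat_set_iff_bounded[of F] F(1) by blast
    then show ?thesis using F(2) by (intro exI[of _ N]) blast
  qed
  then obtain N where N: "\<And>k. K k \<times> K k \<subseteq> (\<Union>n<N k. U k n \<times> V k n)" by metis
  show ?thesis
  proof (rule that[of "\<lambda>k. K k - Z k" "\<lambda>k. K k - W k" K N])
    show "(K k - Z k) \<times> (K k - W k) \<subseteq> (\<Union>n<N k. A n \<times> B n)" for k
    proof clarify
      fix x y assume xy: "x \<in> K k" "x \<notin> Z k" "y \<in> K k" "y \<notin> W k"
      then obtain n where "n < N k" "x \<in> U k n" "y \<in> V k n" using N[of k] by blast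
      then show "(x, y) \<in> (\<Union>n<N k. A n \<times> B n)" using U(3)[of k n] V(3)[of k n] xy by blast
    qed
    show "AE x in m. \<forall>\<^sub>F k in sequentially. x \<in> K k - Z k"
      using U(5) by eventually_elim (use evK in \<open>auto intro: eventually_conj\<close>)
    show "AE x in m. \<forall>\<^sub>F k in sequentially. x \<in> K k - W k"
      using V(5) by eventually_elim (use evK in \<open>auto intro: eventually_conj\<close>)
  qed (use K U(4) V(4) compact_borel in auto)
qed

lemma L2_truncation_converges:
  assumes f: "f \<in> L2 m" and X: "\<And>k. X k \<in> sets borel" "AE x in m. \<forall>\<^sub>F k in sequentially. x \<in> X k"
  shows "(\<lambda>k. L2_norm m (\<lambda>x. indicator (- X k) x * f x)) \<longlonglongrightarrow> 0"
proof (rule L2_dominated_convergence[OF f])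
  show "(\<lambda>x. indicator (- X k) x * f x) \<in> borel_measurable m" for k
    by (intro borel_measurable_times borel_measurable_indicator L2_measurable[OF f])
       (simp add: X(1) borel_comp)
  show "cmod (indicator (- X k) x * f x) \<le> cmod (f x)" for k x by (simp add: indicator_def)
  show "AE x in m. (\<lambda>k. indicator (- X k) x * f x) \<longlonglongrightarrow> 0"
    using X(2)
  proof eventually_elim
    case (elim x)
    then have "\<forall>\<^sub>F k in sequentially. indicator (- X k) x * f x = 0" by eventually_elim simp
    then show ?case by (rule tendsto_eventually)
  qed
qed


section \<open>Localised coefficient functions in the projective tensor square\<close>

text \<open>
  This turns the pointwise Bessel inequality for vectors depending on \<open>x\<close> into square summability of
  the \<open>L\<^sup>2\<close> norms of their coefficients.
\<close>

lemma pointwise_square_summable: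
  fixes c :: "nat \<Rightarrow> 'a \<Rightarrow> complex"
  assumes c: "\<And>i. c i \<in> borel_measurable m" and bound: "\<And>n x. (\<Sum>i<n. (cmod (c i x))\<^sup>2) \<le> C"
    and K: "K \<in> sets borel" "emeasure m K < \<infinity>"
  shows "(\<lambda>x. indicator K x * c i x) \<in> L2 m"
    and "(\<Sum>i<n. (L2_norm m (\<lambda>x. indicator K x * c i x))\<^sup>2) \<le> C * measure m K"
proof -
  have int: "integrable m (\<lambda>x. C * indicator K x)" using K by (simp add: less_top)
  have sq: "(cmod (indicator K x * c i x))\<^sup>2 = indicator K x * (cmod (c i x))\<^sup>2" for i x
    by (simp add: indicator_def)
  have one: "(cmod (c i x))\<^sup>2 \<le> C" for i x
  proof -
    have "(cmod (c i x))\<^sup>2 \<le> (\<Sum>j<Suc i. (cmod (c j x))\<^sup>2)"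
      by (rule member_le_sum) auto
    then show ?thesis using bound[where n="Suc i" and x=x] by linarith
  qed
  have meas [measurable]: "(\<lambda>x. indicator K x * c i x) \<in> borel_measurable m" for i
    using c K by (intro borel_measurable_times borel_measurable_indicator) auto
  show L: "(\<lambda>x. indicator K x * c i x) \<in> L2 m" for i
    unfolding L2_def mem_Collect_eq
  proof (intro conjI meas)
    show "integrable m (\<lambda>x. (cmod (indicator K x * c i x))\<^sup>2)"
    proof (rule Bochner_Integration.integrable_bound[OF int])
      show "AE x in m. norm ((cmod (indicator K x * c i x))\<^sup>2) \<le> norm (C * indicator K x)"
        using one[of i] order_trans[OF zero_le_power2 one] by (auto simp: indicator_def)
    qed measurable
  qed
  have "(\<Sum>i<n. (L2_norm m (\<lambda>x. indicator K x * c i x))\<^sup>2) = (LINT x|m. (\<Sum>i<n. (cmod (indicator K x * c i x))\<^sup>2))"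
    unfolding L2_norm_square using L2_integrable[OF L] by simp
  also have "\<dots> \<le> (LINT x|m. C * indicator K x)"
  proof (rule integral_mono[OF _ int])
    show "(\<Sum>i<n. (cmod (indicator K x * c i x))\<^sup>2) \<le> C * indicator K x" for x
      using bound[where n=n and x=x] by (auto simp: indicator_def)
  qed (use L2_integrable[OF L] in auto)
  also have "\<dots> = C * measure m K" using K by simp
  finally show "(\<Sum>i<n. (L2_norm m (\<lambda>x. indicator K x * c i x))\<^sup>2) \<le> C * measure m K" .
qed

lemma coefficient_l2_inner:
  assumes "\<xi> \<in> L2 m" "\<eta> \<in> L2 m"
  shows "coefficient m \<xi> \<eta> (x - y) = l2_inner m (\<lambda>z. \<xi> (y + z)) (\<lambda>z. \<eta> (x + z))"
proof -
  note [measurable] = L2_measurable[OF assms(1)] L2_measurable[OF L2_cnj[OF assms(2)]]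
  have "coefficient m \<xi> \<eta> (x - y) = (LINT t|m. \<xi> (y - x + t) * cnj (\<eta> t))"
    by (simp add: coefficient_def left_regular_def)
  also have "\<dots> = (LINT z|m. \<xi> (y - x + (x + z)) * cnj (\<eta> (x + z)))"
    by (rule integral_translate[symmetric]) measurable
  also have "\<dots> = l2_inner m (\<lambda>z. \<xi> (y + z)) (\<lambda>z. \<eta> (x + z))"
    unfolding l2_inner_def by (simp add: add.assoc[symmetric])
  finally show ?thesis .
qed

text \<open>
  Translations are continuous on \<open>L\<^sup>2\<close>, so the translates of \<open>\<eta>\<close> by a countable dense set approximate all
  translates of \<open>\<eta>\<close>.  Orthonormalising these countably many vectors is enough.
\<close>

lemma translates_orthonormal:
  assumes \<eta>: "\<eta> \<in> L2 m"
  obtains e where "orthonormal_or_zero m e"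
    "\<And>x g. g \<in> L2 m \<Longrightarrow>
      (\<lambda>i. l2_inner m (\<lambda>z. \<eta> (x + z)) (e i) * l2_inner m (e i) g) sums l2_inner m (\<lambda>z. \<eta> (x + z)) g"
proof -
  obtain D :: "'a set" where D: "countable D" "\<And>X. open X \<Longrightarrow> X \<noteq> {} \<Longrightarrow> \<exists>d\<in>D. d \<in> X"
    using countable_dense_setE by metis
  have "D \<noteq> {}" using D(2)[of UNIV] by auto
  define d where "d = from_nat_into D"
  have d: "\<exists>n. d n \<in> X" if "open X" "X \<noteq> {}" for X
    using D(2)[OF that] D(1) \<open>D \<noteq> {}\<close> unfolding d_def by (metis from_nat_into_surj)
  define v where "v n = (\<lambda>z. \<eta> (d n + z))" for n
  have v: "v n \<in> L2 m" for n unfolding v_def by (rule L2_translate(1)[OF \<eta>])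
  define e where "e = gram_schmidt m v"
  have e: "orthonormal_or_zero m e" unfolding e_def by (rule gram_schmidt_orthonormal[OF v])
  have "(\<lambda>i. l2_inner m (\<lambda>z. \<eta> (x + z)) (e i) * l2_inner m (e i) g) sums l2_inner m (\<lambda>z. \<eta> (x + z)) g"
    if g: "g \<in> L2 m" for x g
  proof (rule Parseval_of_approximation[OF e L2_translate(1)[OF \<eta>] g])
    fix \<epsilon> :: real assume "0 < \<epsilon>"
    then have "\<forall>\<^sub>F t in nhds 0. L2_norm m (\<lambda>z. \<eta> (t + z) - \<eta> z) < \<epsilon>"
      using order_tendstoD(2)[OF L2_strongly_continuous[OF \<eta>]] by blast
    then obtain W where W: "open W" "0 \<in> W" "\<And>t. t \<in> W \<Longrightarrow> L2_norm m (\<lambda>z. \<eta> (t + z) - \<eta> z) < \<epsilon>"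
      unfolding eventually_nhds by blast
    have "open ((\<lambda>y. x - y) -` W)"
      using W(1) unfolding diff_conv_add_uminus
      by (intro open_vimage) (auto simp: continuous_on_def intro!: tendsto_intros)
    moreover have "x \<in> (\<lambda>y. x - y) -` W" using W(2) by simp
    ultimately obtain n where n: "x - d n \<in> W" using d[of "(\<lambda>y. x - y) -` W"] by blast
    have "L2_norm m (\<lambda>z. \<eta> (x + z) - v n z) = L2_norm m (\<lambda>z. \<eta> (x - d n + (d n + z)) - \<eta> (d n + z))"
      unfolding v_def by (metis add.assoc diff_add_cancel)
    also have "\<dots> = L2_norm m (\<lambda>z. \<eta> (x - d n + z) - \<eta> z)"
      by (rule L2_norm_diff_translate[OF L2_translate(1)[OF \<eta>] \<eta>])
    also have "\<dots> < \<epsilon>" by (rule W(3)[OF n])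
    finally have "L2_norm m (\<lambda>z. \<eta> (x + z) - v n z) < \<epsilon>" .
    moreover have "\<forall>k\<ge>Suc n. L2_norm m (\<lambda>z. v n z - projection m e k (v n) z) = 0"
      unfolding e_def using gram_schmidt_projection[of v m, OF v] by auto
    ultimately show "\<exists>h k. h \<in> L2 m \<and> L2_norm m (\<lambda>z. \<eta> (x + z) - h z) < \<epsilon> \<and>
        (\<forall>n\<ge>k. L2_norm m (\<lambda>x. h x - projection m e n h x) = 0)"
      using v by blast
  qed
  with e show ?thesis by (rule that)
qed

text \<open>
  By invariance of \<open>m\<close>, \<open>u(x - y)\<close> is the inner product of the translates of \<open>\<xi>\<close> by \<open>y\<close> and of \<open>\<eta>\<close> by
  \<open>x\<close>.  Its Parseval expansion separates the variables.  The Bessel inequality bounds the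
  coefficients uniformly in \<open>x\<close> and \<open>y\<close>, and the cut-off to sets of finite measure makes this bound
  integrable.
\<close>

lemma localised_coefficient_represents:
  assumes \<xi>: "\<xi> \<in> L2 m" and \<eta>: "\<eta> \<in> L2 m"
    and K: "K \<in> sets borel" "emeasure m K < \<infinity>" and L: "L \<in> sets borel" "emeasure m L < \<infinity>"
  obtains f g where "L2_pairs m f g"
    "\<And>x y. (\<lambda>n. f n x * g n y) sums (indicator K x * indicator L y * coefficient m \<xi> \<eta> (x - y))"
proof -
  obtain e where e: "orthonormal_or_zero m e" and P: "\<And>x g. g \<in> L2 m \<Longrightarrow>
      (\<lambda>i. l2_inner m (\<lambda>z. \<eta> (x + z)) (e i) * l2_inner m (e i) g) sums l2_inner m (\<lambda>z. \<eta> (x + z)) g"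
    using translates_orthonormal[OF \<eta>] by metis
  have eL: "e i \<in> L2 m" for i using e by (simp add: orthonormal_or_zero_def)
  have [measurable]: "e i \<in> borel_measurable m" "(\<lambda>x. cnj (e i x)) \<in> borel_measurable m"
    "\<xi> \<in> borel_measurable m" "(\<lambda>x. cnj (\<eta> x)) \<in> borel_measurable m" for i
    using eL[of i] \<xi> \<eta> by (auto intro: L2_measurable L2_cnj)
  define c c' where "c i x = l2_inner m (e i) (\<lambda>z. \<eta> (x + z))"
    and "c' i y = l2_inner m (\<lambda>z. \<xi> (y + z)) (e i)" for i x y
  have cm: "c i \<in> borel_measurable m" for i
    unfolding c_def[abs_def] l2_inner_def by measurable
  have c'm: "c' i \<in> borel_measurable m" for i
    unfolding c'_def[abs_def] l2_inner_def by measurable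
  have cb: "(\<Sum>i<n. (cmod (c i x))\<^sup>2) \<le> (L2_norm m \<eta>)\<^sup>2" for n x
    using Bessel[OF e L2_translate(1)[OF \<eta>], of x n] L2_translate(2)[OF \<eta>, of x]
      arg_cong[OF l2_inner_commute[of m "e _"], of cmod]
    unfolding c_def by simp
  have c'b: "(\<Sum>i<n. (cmod (c' i x))\<^sup>2) \<le> (L2_norm m \<xi>)\<^sup>2" for n x
    using Bessel[OF e L2_translate(1)[OF \<xi>], of x n] L2_translate(2)[OF \<xi>, of x] unfolding c'_def by simp
  define f g where "f i = (\<lambda>x. indicator K x * c i x)" and "g i = (\<lambda>y. indicator L y * c' i y)" for i
  note F = pointwise_square_summable[OF cm cb K, folded f_def]
    and G = pointwise_square_summable[OF c'm c'b L, folded g_def]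
  have "summable (\<lambda>n. L2_norm m (f n) * L2_norm m (g n))"
  proof (rule summableI_nonneg_bounded)
    show "0 \<le> L2_norm m (f n) * L2_norm m (g n)" for n by (simp add: L2_norm_nonneg)
    fix n
    have "L2_norm m (f i) * L2_norm m (g i) \<le> (L2_norm m (f i))\<^sup>2 + (L2_norm m (g i))\<^sup>2" for i
    proof -
      have "0 \<le> L2_norm m (f i) * L2_norm m (g i)" by (simp add: L2_norm_nonneg)
      moreover have "0 \<le> (L2_norm m (f i))\<^sup>2 + (L2_norm m (g i))\<^sup>2 - 2 * (L2_norm m (f i) * L2_norm m (g i))"
        using zero_le_power2[of "L2_norm m (f i) - L2_norm m (g i)"] by (simp add: power2_diff mult.assoc)
      ultimately show ?thesis by linarith
    qed
    then have "(\<Sum>i<n. L2_norm m (f i) * L2_norm m (g i)) \<le> (\<Sum>i<n. (L2_norm m (f i))\<^sup>2) + (\<Sum>i<n. (L2_norm m (g i))\<^sup>2)"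
      unfolding sum.distrib[symmetric] by (intro sum_mono)
    also have "\<dots> \<le> (L2_norm m \<eta>)\<^sup>2 * measure m K + (L2_norm m \<xi>)\<^sup>2 * measure m L"
      by (intro add_mono F(2) G(2))
    finally show "(\<Sum>i<n. L2_norm m (f i) * L2_norm m (g i)) \<le> (L2_norm m \<eta>)\<^sup>2 * measure m K + (L2_norm m \<xi>)\<^sup>2 * measure m L" .
  qed
  then have "L2_pairs m f g" using F(1) G(1) by (simp add: L2_pairs_def)
  moreover have "(\<lambda>n. f n x * g n y) sums (indicator K x * indicator L y * coefficient m \<xi> \<eta> (x - y))" for x y
  proof -
    have "(\<lambda>i. cnj (l2_inner m (\<lambda>z. \<eta> (x + z)) (e i) * l2_inner m (e i) (\<lambda>z. \<xi> (y + z))))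
        sums cnj (l2_inner m (\<lambda>z. \<eta> (x + z)) (\<lambda>z. \<xi> (y + z)))"
      unfolding sums_cnj by (rule P[OF L2_translate(1)[OF \<xi>]])
    then have "(\<lambda>i. c i x * c' i y) sums coefficient m \<xi> \<eta> (x - y)"
      unfolding complex_cnj_mult l2_inner_commute[symmetric] c_def c'_def coefficient_l2_inner[OF \<xi> \<eta>] .
    then have "(\<lambda>i. (indicator K x * indicator L y) * (c i x * c' i y)) sums ((indicator K x * indicator L y) * coefficient m \<xi> \<eta> (x - y))"
      by (rule sums_mult)
    then show ?thesis unfolding f_def g_def by (simp add: mult_ac)
  qed
  ultimately show ?thesis by (rule that)
qed


section \<open>Mollification\<close>

lemma L2_of_nn_integral_le:
  assumes h: "h \<in> borel_measurable m" and le: "(\<integral>\<^sup>+x. ennreal ((cmod (h x))\<^sup>2) \<partial>m) \<le> ennreal (c\<^sup>2)" and "0 \<le> c"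
  shows "h \<in> L2 m" and "L2_norm m h \<le> c"
proof -
  have int: "integrable m (\<lambda>x. (cmod (h x))\<^sup>2)"
  proof (rule integrableI_bounded)
    show "(\<integral>\<^sup>+x. ennreal (norm ((cmod (h x))\<^sup>2)) \<partial>m) < \<infinity>"
      using le_less_trans[OF le ennreal_less_top] by simp
  qed (use h in measurable)
  then show "h \<in> L2 m" using h by (simp add: L2_def)
  have "ennreal (LINT x|m. (cmod (h x))\<^sup>2) = (\<integral>\<^sup>+x. ennreal ((cmod (h x))\<^sup>2) \<partial>m)"
    by (rule nn_integral_eq_integral[symmetric, OF int]) simp
  with le have "ennreal (LINT x|m. (cmod (h x))\<^sup>2) \<le> ennreal (c\<^sup>2)" by (simp only:)
  then have "(LINT x|m. (cmod (h x))\<^sup>2) \<le> c\<^sup>2" by (subst (asm) ennreal_le_iff) auto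
  then show "L2_norm m h \<le> c" unfolding L2_norm_def using \<open>0 \<le> c\<close> by (intro real_le_lsqrt) auto
qed

lemma nn_integral_L2:
  assumes "h \<in> L2 m" shows "(\<integral>\<^sup>+x. ennreal ((cmod (h x))\<^sup>2) \<partial>m) = ennreal ((L2_norm m h)\<^sup>2)"
  unfolding L2_norm_square by (rule nn_integral_eq_integral[OF L2_integrable[OF assms]]) simp

text \<open>
  Apply the Cauchy-Schwarz inequality for each \<open>y\<close> to the normalised restriction of \<open>m\<close> to \<open>V\<close>, and
  then integrate over \<open>y\<close> with the order of integration exchanged.  The inner integral is finite for
  almost every \<open>y\<close> only; for the remaining \<open>y\<close> it has the default value \<open>0\<close>.
\<close>

lemma Minkowski_average:
  fixes h :: "'a \<Rightarrow> 'a \<Rightarrow> complex"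
  assumes h: "case_prod h \<in> borel_measurable (m \<Otimes>\<^sub>M m)"
    and V: "V \<in> sets borel" "emeasure m V < \<infinity>" "measure m V > 0"
    and slice: "\<And>t. t \<in> V \<Longrightarrow> (\<lambda>y. h y t) \<in> L2 m \<and> L2_norm m (\<lambda>y. h y t) \<le> \<delta>" and "0 \<le> \<delta>"
  shows "AE y in m. integrable m (\<lambda>t. indicator V t * h y t)"
    and "(\<lambda>y. (LINT t|m. indicator V t * h y t) / of_real (measure m V)) \<in> L2 m"
    and "L2_norm m (\<lambda>y. (LINT t|m. indicator V t * h y t) / of_real (measure m V)) \<le> \<delta>"
proof -
  define H where "H y = (LINT t|m. indicator V t * h y t) / of_real (measure m V)" for y
  define q where "q y = (\<integral>\<^sup>+t. ennreal ((cmod (indicator V t * h y t))\<^sup>2) \<partial>m)" for y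
  note [measurable] = h V(1)
  have V' [measurable]: "V \<in> sets m" using V by simp
  have ind: "indicator V \<in> L2 m" "L2_norm m (indicator V) = sqrt (measure m V)"
  proof -
    have "(cmod (indicator V x))\<^sup>2 = indicator V x" for x by (simp add: indicator_def)
    then show "indicator V \<in> L2 m" "L2_norm m (indicator V) = sqrt (measure m V)"
      using V by (auto simp: L2_def L2_norm_def less_top)
  qed
  have hm: "(\<lambda>t. indicator V t * h y t) \<in> borel_measurable m" for y by measurable
  have qm: "q \<in> borel_measurable m" unfolding q_def[abs_def] by measurable
  have Hm: "H \<in> borel_measurable m" unfolding H_def[abs_def] by measurable
  have "(\<integral>\<^sup>+y. q y \<partial>m) = (\<integral>\<^sup>+t. (\<integral>\<^sup>+y. ennreal ((cmod (indicator V t * h y t))\<^sup>2) \<partial>m) \<partial>m)"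
    unfolding q_def by (rule Fubini') measurable
  also have "\<dots> \<le> (\<integral>\<^sup>+t. ennreal (\<delta>\<^sup>2) * indicator V t \<partial>m)"
  proof (rule nn_integral_mono)
    fix t
    show "(\<integral>\<^sup>+y. ennreal ((cmod (indicator V t * h y t))\<^sup>2) \<partial>m) \<le> ennreal (\<delta>\<^sup>2) * indicator V t"
    proof (cases "t \<in> V")
      case True
      then show ?thesis using slice[OF True] nn_integral_L2[of "\<lambda>y. h y t"]
        by (auto intro!: ennreal_leI power_mono L2_norm_nonneg)
    qed simp
  qed
  also have "\<dots> = ennreal (\<delta>\<^sup>2 * measure m V)"
    using V by (simp add: nn_integral_cmult_indicator emeasure_eq_ennreal_measure less_top ennreal_mult)
  finally have qint: "(\<integral>\<^sup>+y. q y \<partial>m) \<le> ennreal (\<delta>\<^sup>2 * measure m V)" .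
  have L2slice: "(\<lambda>t. indicator V t * h y t) \<in> L2 m \<and> L2_norm m (\<lambda>t. indicator V t * h y t) \<le> sqrt (enn2real (q y))"
    if "q y < \<infinity>" for y
    using L2_of_nn_integral_le[OF hm, of y "sqrt (enn2real (q y))"] that
    by (simp add: q_def[symmetric] less_top)
  have idem: "indicator V t * (indicator V t * h y t) = indicator V t * h y t" for t y
    by (simp add: indicator_def)
  have "AE y in m. q y \<noteq> \<infinity>"
    using qint by (intro nn_integral_PInf_AE qm) (auto simp: top_unique)
  then show "AE y in m. integrable m (\<lambda>t. indicator V t * h y t)"
  proof eventually_elim
    case (elim y)
    then have "integrable m (\<lambda>t. indicator V t * (indicator V t * h y t))"
      using L2slice[of y] by (intro L2_mult_integrable ind) (auto simp: less_top)
    then show ?case unfolding idem .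
  qed
  \<comment> \<open>Where \<open>q y = \<infinity>\<close> the bound holds whatever default value the integral in \<open>H y\<close> takes.\<close>
  have Hq: "ennreal ((cmod (H y))\<^sup>2) \<le> q y * ennreal (1 / measure m V)" for y
  proof (cases "q y < \<infinity>")
    case False
    then have "q y = top" using top.not_eq_extremum[of "q y"] by auto
    then show ?thesis using V by (simp add: ennreal_top_mult)
  next
    case True
    note Ly = L2slice[OF True]
    have "cmod (LINT t|m. indicator V t * (indicator V t * h y t))
        \<le> L2_norm m (indicator V) * L2_norm m (\<lambda>t. indicator V t * h y t)"
      using Ly by (intro L2_Cauchy_Schwarz_norm ind) auto
    also have "\<dots> \<le> sqrt (measure m V) * sqrt (enn2real (q y))"
      using Ly by (auto simp: ind(2) intro!: mult_left_mono)
    finally have "cmod (LINT t|m. indicator V t * h y t) \<le> sqrt (measure m V) * sqrt (enn2real (q y))"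
      unfolding idem .
    then have "(cmod (LINT t|m. indicator V t * h y t))\<^sup>2 \<le> (sqrt (measure m V) * sqrt (enn2real (q y)))\<^sup>2"
      by (intro power_mono) auto
    also have "\<dots> = measure m V * enn2real (q y)" by (simp add: power_mult_distrib)
    finally have "(cmod (H y))\<^sup>2 \<le> measure m V * enn2real (q y) / (measure m V)\<^sup>2"
      unfolding H_def norm_divide power_divide norm_of_real power2_abs by (rule divide_right_mono) simp
    also have "\<dots> = enn2real (q y) * (1 / measure m V)"
      using V(3) by (simp add: power2_eq_square)
    finally have "ennreal ((cmod (H y))\<^sup>2) \<le> ennreal (enn2real (q y) * (1 / measure m V))" by (rule ennreal_leI)
    also have "\<dots> = q y * ennreal (1 / measure m V)"
      using True V(3) by (subst ennreal_mult) (auto simp: less_top)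
    finally show ?thesis .
  qed
  have "(\<integral>\<^sup>+y. ennreal ((cmod (H y))\<^sup>2) \<partial>m) \<le> (\<integral>\<^sup>+y. q y * ennreal (1 / measure m V) \<partial>m)"
    by (intro nn_integral_mono Hq)
  also have "\<dots> = (\<integral>\<^sup>+y. q y \<partial>m) * ennreal (1 / measure m V)"
    by (rule nn_integral_multc[OF qm])
  also have "\<dots> \<le> ennreal (\<delta>\<^sup>2 * measure m V) * ennreal (1 / measure m V)"
    using qint by (rule mult_right_mono) simp
  also have "\<dots> = ennreal (\<delta>\<^sup>2)"
    using V(3) by (subst ennreal_mult[symmetric]) auto
  finally have "(\<integral>\<^sup>+y. ennreal ((cmod (H y))\<^sup>2) \<partial>m) \<le> ennreal (\<delta>\<^sup>2)" .
  from L2_of_nn_integral_le[OF Hm this \<open>0 \<le> \<delta>\<close>]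
  show "(\<lambda>y. (LINT t|m. indicator V t * h y t) / of_real (measure m V)) \<in> L2 m"
    and "L2_norm m (\<lambda>y. (LINT t|m. indicator V t * h y t) / of_real (measure m V)) \<le> \<delta>"
    unfolding H_def by auto
qed

text \<open>
  The mean of the left translates \<open>left_regular t g\<close> over \<open>t \<in> V\<close>, in other words the convolution of \<open>g\<close> with
  the normalised indicator of \<open>V\<close>.
\<close>

definition average :: "'a set \<Rightarrow> ('a \<Rightarrow> complex) \<Rightarrow> 'a \<Rightarrow> complex" where
  "average V g y = (LINT t|m. indicator V t * g (- t + y)) / of_real (measure m V)"

lemma average_L2:
  assumes g: "g \<in> L2 m" and V: "V \<in> sets borel" "emeasure m V < \<infinity>" "measure m V > 0"
  shows "average V g \<in> L2 m" and "L2_norm m (average V g) \<le> L2_norm m g"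
proof -
  note [measurable] = L2_measurable[OF g]
  have "(\<lambda>(y, t). g (- t + y)) \<in> borel_measurable (m \<Otimes>\<^sub>M m)" by measurable
  note * = Minkowski_average[OF this V, of "L2_norm m g"]
  show "average V g \<in> L2 m" and "L2_norm m (average V g) \<le> L2_norm m g"
    unfolding average_def[abs_def] using *(2,3) L2_translate[OF g] L2_norm_nonneg by auto
qed

lemma average_approximates:
  assumes g: "g \<in> L2 m" and V: "V \<in> sets borel" "emeasure m V < \<infinity>" "measure m V > 0"
    and small: "\<And>t. t \<in> V \<Longrightarrow> L2_norm m (\<lambda>y. g (- t + y) - g y) \<le> \<delta>" and "0 \<le> \<delta>"
  shows "L2_norm m (\<lambda>y. g y - average V g y) \<le> \<delta>"
proof -
  note [measurable] = L2_measurable[OF g]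
  have V' [measurable]: "V \<in> sets m" using V by simp
  have m1: "(\<lambda>(y, t). g (- t + y) - g y) \<in> borel_measurable (m \<Otimes>\<^sub>M m)" by measurable
  have s1: "(\<lambda>y. g (- t + y) - g y) \<in> L2 m" for t by (intro L2_diff L2_translate(1) g)
  have slice: "(\<lambda>y. g (- t + y) - g y) \<in> L2 m \<and> L2_norm m (\<lambda>y. g (- t + y) - g y) \<le> \<delta>" if "t \<in> V" for t
    using s1 small[OF that] by blast
  define H where "H = (\<lambda>y. (LINT t|m. indicator V t * (g (- t + y) - g y)) / of_real (measure m V))"
  have int: "AE y in m. integrable m (\<lambda>t. indicator V t * (g (- t + y) - g y))"
    by (rule Minkowski_average(1)[OF m1 V slice \<open>0 \<le> \<delta>\<close>])
  have HL: "H \<in> L2 m" unfolding H_def by (rule Minkowski_average(2)[OF m1 V slice \<open>0 \<le> \<delta>\<close>])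
  have Hn: "L2_norm m H \<le> \<delta>" unfolding H_def by (rule Minkowski_average(3)[OF m1 V slice \<open>0 \<le> \<delta>\<close>])
  have AE: "AE y in m. (-1) * H y = g y - average V g y"
    using int
  proof eventually_elim
    case (elim y)
    have "integrable m (\<lambda>t. indicator V t *\<^sub>R g y)"
      using V by (intro integrable_scaleR_left) (simp add: less_top)
    moreover have scale: "(\<lambda>t. indicator V t *\<^sub>R g y) = (\<lambda>t. indicator V t * g y)"
      by (auto simp: indicator_def)
    ultimately have iV: "integrable m (\<lambda>t. indicator V t * g y)" by simp
    have "integrable m (\<lambda>t. indicator V t * (g (- t + y) - g y) + indicator V t * g y)"
      by (rule Bochner_Integration.integrable_add[OF elim iV])
    then have i2: "integrable m (\<lambda>t. indicator V t * g (- t + y))" by (simp add: algebra_simps)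
    have "(LINT t|m. indicator V t * (g (- t + y) - g y))
        = (LINT t|m. indicator V t * g (- t + y)) - (LINT t|m. indicator V t * g y)"
      using i2 iV by (simp add: right_diff_distrib)
    also have "(LINT t|m. indicator V t * g y) = of_real (measure m V) * g y"
      unfolding scale[symmetric] using V by (simp add: less_top scaleR_conv_of_real)
    finally show ?case unfolding H_def average_def using V(3) by (simp add: field_simps)
  qed
  have "L2_norm m (\<lambda>y. g y - average V g y) = L2_norm m (\<lambda>y. (-1) * H y)"
    using AE by (intro L2_norm_cong_AE[symmetric] L2_scale HL L2_diff g average_L2 V)
  also have "\<dots> = L2_norm m H" using L2_norm_scale[of m "-1" H] by simp
  finally show ?thesis using Hn by simp
qed

text \<open>
  Averaging the fibre integral over right translates is the same as averaging the second tensor factors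
  over left translates: substitute \<open>z = t + y\<close> in \<open>\<integral> f(s + t + y) g(y) dy\<close> and exchange integrals.
\<close>

lemma fibre_integral_average:
  assumes fg: "L2_pairs m f g" and V: "V \<in> sets borel" "emeasure m V < \<infinity>" "measure m V > 0"
  shows "(LINT t|m. indicator V t * fibre_integral f g (s + t)) / of_real (measure m V)
       = fibre_integral f (\<lambda>n. average V (g n)) s"
proof -
  note L = L2_pairsD[OF fg]
  have [measurable]: "f n \<in> borel_measurable m" "g n \<in> borel_measurable m" for n
    using L by (auto intro: L2_measurable)
  have V' [measurable]: "V \<in> sets m" using V by simp
  define a where "a n t = indicator V t * (LINT z|m. f n (s + z) * g n (- t + z))" for n t
  have bound: "cmod (a n t) \<le> indicator V t * (L2_norm m (f n) * L2_norm m (g n))" for n t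
    using L2_Cauchy_Schwarz_norm[OF L2_translate(1)[OF L(1)[of n], where s=s] L2_translate(1)[OF L(2)[of n], where s="-t"]]
    by (simp add: a_def L2_translate(2)[OF L(1)] L2_translate(2)[OF L(2)] indicator_def)
  have am: "a n \<in> borel_measurable m" for n unfolding a_def[abs_def] by measurable
  have ib: "integrable m (\<lambda>t. indicator V t * c)" for c :: real
    using V by (intro integrable_mult_left) (simp add: less_top)
  have ai: "integrable m (a n)" for n
    by (rule Bochner_Integration.integrable_bound[OF ib am])
       (use order_trans[OF bound abs_ge_self] in auto)
  have sm: "summable (\<lambda>n. cmod (a n t))" for t
    by (rule summable_comparison_test'[OF summable_mult[OF L(3), of "indicator V t"]]) (use bound in auto)
  have smi: "summable (\<lambda>n. LINT t|m. cmod (a n t))"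
  proof (rule summable_comparison_test'[OF summable_mult[OF L(3), of "measure m V"]])
    fix n
    have "(LINT t|m. cmod (a n t)) \<le> (LINT t|m. indicator V t * (L2_norm m (f n) * L2_norm m (g n)))"
      by (intro integral_mono ib integrable_norm ai bound)
    also have "\<dots> = measure m V * (L2_norm m (f n) * L2_norm m (g n))" using V by simp
    finally show "norm (LINT t|m. cmod (a n t)) \<le> measure m V * (L2_norm m (f n) * L2_norm m (g n))" by simp
  qed
  have asum: "(\<lambda>n. a n t) sums (indicator V t * fibre_integral f g (s + t))" for t
  proof -
    have "(LINT y|m. f n (s + t + y) * g n y) = (LINT z|m. f n (s + z) * g n (- t + z))" for n
    proof -
      have "(LINT y|m. f n (s + (t + y)) * g n (- t + (t + y))) = (LINT z|m. f n (s + z) * g n (- t + z))"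
        by (rule integral_translate[where f="\<lambda>z. f n (s + z) * g n (- t + z)"]) measurable
      then show ?thesis by (simp add: add.assoc)
    qed
    then show ?thesis
      using sums_mult[OF fibre_integral_sums[OF fg, of "s + t"], of "indicator V t"] by (simp add: a_def)
  qed
  have inner: "(LINT t|m. a n t) = of_real (measure m V) * (LINT z|m. f n (s + z) * average V (g n) z)" for n
  proof -
    define k where "k t z = indicator V t * (f n (s + z) * g n (- t + z))" for t z
    have km [measurable]: "case_prod k \<in> borel_measurable (m \<Otimes>\<^sub>M m)"
      unfolding k_def by measurable
    have kz: "integrable m (k t)" for t
      unfolding k_def by (intro integrable_mult_right L2_mult_integrable L2_translate(1) L)
    have "integrable (m \<Otimes>\<^sub>M m) (case_prod k)"
    proof (rule Fubini_integrable[OF km])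
      show "AE t in m. integrable m (\<lambda>z. case_prod k (t, z))" using kz by simp
      show "integrable m (\<lambda>t. LINT z|m. norm (case_prod k (t, z)))"
      proof (rule Bochner_Integration.integrable_bound[OF ib[of "L2_norm m (f n) * L2_norm m (g n)"]])
        show "AE t in m. norm (LINT z|m. norm (case_prod k (t, z))) \<le> norm (indicator V t * (L2_norm m (f n) * L2_norm m (g n)))"
        proof (rule AE_I2)
          fix t
          have "(LINT z|m. cmod (f n (s + z) * g n (- t + z))) \<le> L2_norm m (f n) * L2_norm m (g n)"
            using L2_Cauchy_Schwarz[OF L2_translate(1)[OF L(1)[of n], where s=s] L2_translate(1)[OF L(2)[of n], where s="-t"]]
            by (simp add: L2_translate(2)[OF L(1)] L2_translate(2)[OF L(2)])
          then show "norm (LINT z|m. norm (case_prod k (t, z))) \<le> norm (indicator V t * (L2_norm m (f n) * L2_norm m (g n)))"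
            by (auto simp: k_def indicator_def norm_mult L2_norm_nonneg)
        qed
      qed measurable
    qed
    from Fubini_integral[OF this]
    have "(LINT t|m. (LINT z|m. k t z)) = (LINT z|m. (LINT t|m. k t z))" by simp
    moreover have "(LINT z|m. k t z) = a n t" for t by (simp add: k_def a_def)
    moreover have "(LINT t|m. k t z) = of_real (measure m V) * (f n (s + z) * average V (g n) z)" for z
    proof -
      have "(LINT t|m. k t z) = (LINT t|m. f n (s + z) * (indicator V t * g n (- t + z)))"
        by (simp add: k_def mult_ac)
      then show ?thesis using V(3) by (simp add: average_def)
    qed
    ultimately show ?thesis by simp
  qed
  have avgL: "L2_pairs m f (\<lambda>n. average V (g n))"
    by (rule L2_pairs_dominated[OF fg]) (use L average_L2[OF L(2) V] in auto)
  have "(\<lambda>n. LINT t|m. a n t) sums (LINT t|m. (\<Sum>n. a n t))"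
    by (rule sums_integral[OF ai AE_I2[OF sm] smi])
  also have "(\<lambda>t. \<Sum>n. a n t) = (\<lambda>t. indicator V t * fibre_integral f g (s + t))"
    using asum by (auto simp: sums_iff)
  finally have "(\<lambda>n. (LINT t|m. a n t) / of_real (measure m V)) sums ((LINT t|m. indicator V t * fibre_integral f g (s + t)) / of_real (measure m V))"
    by (rule sums_divide)
  moreover have "(LINT t|m. a n t) / of_real (measure m V) = (LINT z|m. f n (s + z) * average V (g n) z)" for n
    using V(3) by (simp add: inner)
  ultimately show ?thesis
    using fibre_integral_sums[OF avgL, of s] by (simp add: sums_iff)
qed


section \<open>From coefficient functions to the projective tensor square and back\<close>

lemma fibre_integral_measurable:
  assumes "L2_pairs m f g" shows "fibre_integral f g \<in> borel_measurable m"
proof -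
  note L = L2_pairsD[OF assms]
  have [measurable]: "f n \<in> borel_measurable m" "g n \<in> borel_measurable m" for n
    using L by (auto intro: L2_measurable)
  show ?thesis unfolding fibre_integral_def[abs_def] by measurable
qed

lemma fibre_integral_bounded:
  assumes "L2_pairs m f g"
  shows "cmod (fibre_integral f g s) \<le> (\<Sum>n. L2_norm m (f n) * L2_norm m (g n))"
proof -
  note L = L2_pairsD[OF assms]
  have b: "cmod (LINT y|m. f n (s + y) * g n y) \<le> L2_norm m (f n) * L2_norm m (g n)" for n
    using L2_Cauchy_Schwarz_norm[OF L2_translate(1)[OF L(1)[of n], where s=s] L(2)[of n]]
    by (simp add: L2_translate(2)[OF L(1)])
  have "fibre_integral f g s = (\<Sum>n. LINT y|m. f n (s + y) * g n y)"
    using fibre_integral_sums[OF assms] by (simp add: sums_iff)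
  then show ?thesis using norm_suminf_le[OF b L(3)] by simp
qed

lemma L2_of_finite_support:
  fixes v :: "'a \<Rightarrow> complex"
  assumes v: "v \<in> borel_measurable m" "\<And>s. cmod (v s) \<le> C" "\<And>s. s \<notin> S \<Longrightarrow> v s = 0"
    and S: "S \<in> sets borel" "emeasure m S < \<infinity>"
  shows "v \<in> L2 m"
  unfolding L2_def mem_Collect_eq
proof (intro conjI v(1))
  have "integrable m (\<lambda>s. C\<^sup>2 * indicator S s)" using S by (simp add: less_top)
  then show "integrable m (\<lambda>s. (cmod (v s))\<^sup>2)"
  proof (rule Bochner_Integration.integrable_bound)
    show "AE s in m. norm ((cmod (v s))\<^sup>2) \<le> norm (C\<^sup>2 * indicator S s)"
      using v(2,3) by (intro AE_I2) (auto simp: indicator_def intro!: power_mono)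
  qed (use v(1) in measurable)
qed

text \<open>
  The function \<open>w(x, y) = u(x - y) 1\<^sub>K(x) 1\<^sub>L(y) / m(L)\<close> works as soon as \<open>L\<close> has positive measure and \<open>K\<close>
  contains \<open>supp u + L\<close>: the factor \<open>1\<^sub>K\<close> is then invisible wherever \<open>u(x - y) 1\<^sub>L(y)\<close> is nonzero.
\<close>

lemma lift_to_tensor_square:
  assumes u: "u \<in> fourier_algebra m" and supp: "compact (closure {s. u s \<noteq> 0})"
  obtains f g w where "represents m f g w" "\<And>s. fibre_integral f g s = u s"
    "\<And>x y. u (x - y) = 0 \<Longrightarrow> w (x, y) = 0"
proof -
  obtain \<xi> \<eta> where \<xi>: "\<xi> \<in> L2 m" and \<eta>: "\<eta> \<in> L2 m" and ueq: "u = coefficient m \<xi> \<eta>"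
    using u by (auto simp: fourier_algebra_def)
  obtain U L where U: "open U" "compact L" "0 \<in> U" "U \<subseteq> (L :: 'a set)"
    using locally_compact unfolding locally_compact_space_def by simp blast
  have LB: "L \<in> sets borel" "emeasure m L < \<infinity>" using U(2) compact_borel emeasure_compact by auto
  have "emeasure m L \<noteq> 0"
  proof
    assume "emeasure m L = 0"
    then have "emeasure m U = 0" using emeasure_mono[OF U(4), of m] LB by simp
    then show False using emeasure_open_pos[OF U(1)] U(3) by auto
  qed
  then have Lpos: "0 < measure m L"
    using LB by (simp add: measure_def enn2real_positive_iff zero_less_iff_neq_zero)
  define K where "K = (\<lambda>p. fst p + snd p) ` (closure {s. u s \<noteq> 0} \<times> L)"
  have "compact K" unfolding K_def
    by (intro compact_continuous_image compact_Times supp U(2) continuous_intros)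
  then have KB: "K \<in> sets borel" "emeasure m K < \<infinity>" using compact_borel emeasure_compact by auto
  have KL: "s + y \<in> K" if "u s \<noteq> 0" "y \<in> L" for s y
    using that closure_subset[of "{s. u s \<noteq> 0}"] unfolding K_def
    by (intro image_eqI[of _ _ "(s, y)"]) auto
  obtain f g where fg: "L2_pairs m f g"
    "\<And>x y. (\<lambda>n. f n x * g n y) sums (indicator K x * indicator L y * u (x - y))"
    using localised_coefficient_represents[OF \<xi> \<eta> KB LB] unfolding ueq by metis
  define c where "c = complex_of_real (1 / measure m L)"
  define f' where "f' n = (\<lambda>x. c * f n x)" for n
  define w where "w = (\<lambda>(x, y). c * (indicator K x * indicator L y * u (x - y)))"
  have sums: "(\<lambda>n. f' n x * g n y) sums w (x, y)" for x y
    using sums_mult[OF fg(2), of c] by (simp add: f'_def w_def mult.assoc)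
  have f'g: "L2_pairs m f' g"
    using fg(1) summable_mult[OF L2_pairsD(3)[OF fg(1)], of "cmod c"]
    by (simp add: L2_pairs_def f'_def L2_scale L2_norm_scale mult.assoc)
  have "represents m f' g w"
    using f'g sums marginally_null_empty[of m] by (simp add: represents_def L2_pairs_def)
  moreover have "fibre_integral f' g s = u s" for s
  proof -
    have "(\<Sum>n. f' n (s + y) * g n y) = indicator L y *\<^sub>R (c * u s)" for y
      using sums[of "s + y" y] KL[of s y] by (auto simp: sums_iff w_def indicator_def)
    then have "fibre_integral f' g s = measure m L *\<^sub>R (c * u s)"
      unfolding fibre_integral_def using LB by (simp add: less_top)
    then show ?thesis using Lpos by (simp add: c_def scaleR_conv_of_real)
  qed
  moreover have "w (x, y) = 0" if "u (x - y) = 0" for x y using that by (simp add: w_def)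
  ultimately show ?thesis by (rule that)
qed

text \<open>
  The neighbourhood \<open>W\<close> provides the room between \<open>A - B\<close> and \<open>E\<close> that is lost again when functions
  carried by \<open>A - B\<close> are averaged.
\<close>

lemma rectangles_avoiding_closed_set:
  assumes "closed (E :: 'a set)"
  obtains \<R> where "countable \<R>" "\<Union>((\<lambda>(A, B). A \<times> B) ` \<R>) = - star_set E"
    "\<And>A B. (A, B) \<in> \<R> \<Longrightarrow> open A \<and> open B \<and>
       (\<exists>W. open W \<and> 0 \<in> W \<and> (\<forall>a\<in>A. \<forall>b\<in>B. \<forall>t\<in>W. a - b - t \<notin> E))"
proof -
  obtain \<B> :: "'a set set" where \<B>: "countable \<B>" "topological_basis \<B>" using ex_countable_basis by blast
  define avoids where "avoids A B \<longleftrightarrow> (\<exists>W. open W \<and> 0 \<in> W \<and> (\<forall>a\<in>A. \<forall>b\<in>B. \<forall>t\<in>W. a - b - t \<notin> E))" for A B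
  define \<R> where "\<R> = {(A, B) \<in> \<B> \<times> \<B>. avoids A B}"
  show ?thesis
  proof (rule that[of \<R>])
    have "countable (\<B> \<times> \<B>)" using \<B>(1) by simp
    then show "countable \<R>" by (rule countable_subset[rotated]) (auto simp: \<R>_def)
    show "open A \<and> open B \<and> (\<exists>W. open W \<and> 0 \<in> W \<and> (\<forall>a\<in>A. \<forall>b\<in>B. \<forall>t\<in>W. a - b - t \<notin> E))"
      if "(A, B) \<in> \<R>" for A B
      using that topological_basis_open[OF \<B>(2)] by (auto simp: \<R>_def avoids_def)
    show "\<Union>((\<lambda>(A, B). A \<times> B) ` \<R>) = - star_set E"
    proof (intro equalityI subsetI)
      fix p assume "p \<in> \<Union>((\<lambda>(A, B). A \<times> B) ` \<R>)"
      then obtain A B W where "p \<in> A \<times> B" "0 \<in> W" "\<forall>a\<in>A. \<forall>b\<in>B. \<forall>t\<in>W. a - b - t \<notin> E"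
        by (auto simp: \<R>_def avoids_def)
      then show "p \<in> - star_set E" by (force simp: star_set_def)
    next
      fix p assume "p \<in> - star_set E"
      then obtain x y where p: "p = (x, y)" "x - y \<notin> E" by (cases p) (auto simp: star_set_def)
      have lim: "((\<lambda>q. fst q + - fst (snd q) + - snd (snd q)) \<longlongrightarrow> x + - y + - 0) (nhds x \<times>\<^sub>F (nhds y \<times>\<^sub>F nhds 0))"
        by (intro tendsto_add tendsto_minus filterlim_fst
              filterlim_compose[OF filterlim_fst filterlim_snd] filterlim_compose[OF filterlim_snd filterlim_snd])
      have "\<forall>\<^sub>F q in nhds x \<times>\<^sub>F (nhds y \<times>\<^sub>F nhds 0). fst q + - fst (snd q) + - snd (snd q) \<in> - E"
        using assms p by (intro topological_tendstoD[OF lim]) auto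
      then obtain A' Q where AQ: "\<forall>\<^sub>F a in nhds x. A' a" "\<forall>\<^sub>F q in nhds y \<times>\<^sub>F nhds 0. Q q"
        "\<And>a q. A' a \<Longrightarrow> Q q \<Longrightarrow> a + - fst q + - snd q \<in> - E"
        unfolding eventually_prod_filter[of _ "nhds x"] by auto
      obtain B' W' where BW: "\<forall>\<^sub>F b in nhds y. B' b" "\<forall>\<^sub>F t in nhds 0. W' t" "\<And>b t. B' b \<Longrightarrow> W' t \<Longrightarrow> Q (b, t)"
        using AQ(2) unfolding eventually_prod_filter by auto
      obtain A1 where A1: "open A1" "x \<in> A1" "\<And>a. a \<in> A1 \<Longrightarrow> A' a"
        using AQ(1) unfolding eventually_nhds by auto
      obtain B1 where B1: "open B1" "y \<in> B1" "\<And>a. a \<in> B1 \<Longrightarrow> B' a"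
        using BW(1) unfolding eventually_nhds by auto
      obtain W1 where W1: "open W1" "0 \<in> W1" "\<And>a. a \<in> W1 \<Longrightarrow> W' a"
        using BW(2) unfolding eventually_nhds by auto
      obtain A where A: "A \<in> \<B>" "x \<in> A" "A \<subseteq> A1" using topological_basisE[OF \<B>(2) A1(1,2)] .
      obtain B where B: "B \<in> \<B>" "y \<in> B" "B \<subseteq> B1" using topological_basisE[OF \<B>(2) B1(1,2)] .
      have "a - b - t \<notin> E" if "a \<in> A" "b \<in> B" "t \<in> W1" for a b t
        using AQ(3)[OF A1(3) BW(3)[OF B1(3) W1(3)], of a b t] that A B by auto
      then have "(A, B) \<in> \<R>" using A B W1 by (auto simp: \<R>_def avoids_def)
      then show "p \<in> \<Union>((\<lambda>(A, B). A \<times> B) ` \<R>)" using A B p by blast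
    qed
  qed
qed

text \<open>
  The average of an \<open>L\<^sup>2\<close> function over right translates by \<open>V\<close> is one coefficient function, with
  \<open>1\<^sub>V / m(V)\<close> as its first vector.  By dominated convergence for series, its distance from the fibre
  integral tends to \<open>0\<close> along a neighbourhood basis of \<open>0\<close>.
\<close>

lemma mollification:
  assumes fg: "L2_pairs m f g" and L2: "fibre_integral f g \<in> L2 m" and V0: "open V0" "0 \<in> V0" and "0 < \<delta>"
  obtains v c where "v \<in> fourier_algebra m" "coefficient_series m (\<lambda>s. fibre_integral f g s - v s) c" "c < \<delta>"
    "\<And>s. \<forall>t\<in>V0. fibre_integral f g (s + t) = 0 \<Longrightarrow> v s = 0"
proof -
  note L = L2_pairsD[OF fg]
  obtain U0 where U0: "open U0" "0 \<in> U0" "emeasure m U0 < \<infinity>" using finite_measure_neighbourhood .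
  obtain A :: "nat \<Rightarrow> 'a set" where A: "\<And>i. open (A i)" "\<And>i. 0 \<in> A i"
    "\<And>S. open S \<Longrightarrow> 0 \<in> S \<Longrightarrow> eventually (\<lambda>i. A i \<subseteq> S) sequentially"
    using countable_basis_at_decseq[of 0] by metis
  \<comment> \<open>The factor \<open>U0\<close> makes the measure of \<open>V i\<close> finite.\<close>
  define V where "V i = A i \<inter> V0 \<inter> U0" for i
  have Vo: "open (V i)" "0 \<in> V i" for i unfolding V_def using A V0 U0 by auto
  have Vfin: "emeasure m (V i) < \<infinity>" for i
    using emeasure_mono[of "V i" U0 m] U0 by (auto simp: V_def intro: le_less_trans)
  have Vpos: "measure m (V i) > 0" for i
    using emeasure_open_pos[OF Vo(1)[of i]] Vo(2)[of i] Vfin[of i]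
    by (auto simp: measure_def enn2real_positive_iff zero_less_iff_neq_zero)
  have V: "V i \<in> sets borel" "emeasure m (V i) < \<infinity>" "measure m (V i) > 0" for i
    using Vo Vfin Vpos by auto
  have dL: "(\<lambda>y. g n y - average (V i) (g n) y) \<in> L2 m" for n i
    by (intro L2_diff L average_L2 V)
  have dB: "L2_norm m (\<lambda>y. g n y - average (V i) (g n) y) \<le> 2 * L2_norm m (g n)" for n i
    using L2_triangle_diff[OF L(2)[of n] average_L2(1)[OF L(2)[of n] V[of i]]] average_L2(2)[OF L(2)[of n] V[of i]] by linarith
  have conv: "(\<lambda>i. L2_norm m (\<lambda>y. g n y - average (V i) (g n) y)) \<longlonglongrightarrow> 0" for n
  proof (rule LIMSEQ_I)
    fix r :: real assume "0 < r"
    then have "\<forall>\<^sub>F t in nhds 0. L2_norm m (\<lambda>y. g n (t + y) - g n y) < r / 2"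
      using order_tendstoD(2)[OF L2_strongly_continuous[OF L(2)], of "r / 2"] by simp
    then have "\<forall>\<^sub>F t in nhds (- 0). L2_norm m (\<lambda>y. g n (t + y) - g n y) < r / 2" by simp
    then have "\<forall>\<^sub>F t in nhds 0. L2_norm m (\<lambda>y. g n (- t + y) - g n y) < r / 2"
      using tendsto_uminus_nhds[of "0::'a"] by (rule eventually_compose_filterlim)
    then obtain S where S: "open S" "0 \<in> S" "\<And>t. t \<in> S \<Longrightarrow> L2_norm m (\<lambda>y. g n (- t + y) - g n y) < r / 2"
      unfolding eventually_nhds by blast
    obtain i0 where i0: "\<And>i. i \<ge> i0 \<Longrightarrow> A i \<subseteq> S" using A(3)[OF S(1,2)] unfolding eventually_sequentially by blast
    have "norm (L2_norm m (\<lambda>y. g n y - average (V i) (g n) y) - 0) < r" if "i \<ge> i0" for i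
    proof -
      have "L2_norm m (\<lambda>y. g n (- t + y) - g n y) \<le> r / 2" if "t \<in> V i" for t
        using S(3)[of t] i0[OF \<open>i \<ge> i0\<close>] that by (auto simp: V_def)
      then have "L2_norm m (\<lambda>y. g n y - average (V i) (g n) y) \<le> r / 2"
        using \<open>0 < r\<close> by (intro average_approximates L V) auto
      then show ?thesis using \<open>0 < r\<close> L2_norm_nonneg[of m] by simp
    qed
    then show "\<exists>no. \<forall>i\<ge>no. norm (L2_norm m (\<lambda>y. g n y - average (V i) (g n) y) - 0) < r" by blast
  qed
  have "(\<lambda>i. \<Sum>n. L2_norm m (f n) * L2_norm m (\<lambda>y. g n y - average (V i) (g n) y)) \<longlonglongrightarrow> 0"
  proof (rule suminf_tendsto_zero)
    show "(\<lambda>i. L2_norm m (f n) * L2_norm m (\<lambda>y. g n y - average (V i) (g n) y)) \<longlonglongrightarrow> 0" for n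
      by (rule tendsto_mult_right_zero[OF conv])
    show "\<bar>L2_norm m (f n) * L2_norm m (\<lambda>y. g n y - average (V i) (g n) y)\<bar> \<le> 2 * (L2_norm m (f n) * L2_norm m (g n))" for n i
      using mult_left_mono[OF dB[of n i] L2_norm_nonneg[of m "f n"]] by (simp add: abs_mult L2_norm_nonneg)
    show "summable (\<lambda>n. 2 * (L2_norm m (f n) * L2_norm m (g n)))" by (intro summable_mult L)
  qed
  then obtain i where i: "(\<Sum>n. L2_norm m (f n) * L2_norm m (\<lambda>y. g n y - average (V i) (g n) y)) < \<delta>"
    using order_tendstoD(2)[OF _ \<open>0 < \<delta>\<close>] by (metis (mono_tags, lifting) eventually_happens sequentially_bot)
  define h where "h n = (\<lambda>y. g n y - average (V i) (g n) y)" for n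
  have fh: "L2_pairs m f h"
  proof -
    have "L2_pairs m f (\<lambda>n y. 2 * g n y)"
      using fg summable_mult[OF L(3), of 2] by (simp add: L2_pairs_def L2_scale L2_norm_scale mult_ac)
    then show ?thesis
      by (rule L2_pairs_dominated) (use L dL dB in \<open>auto simp: h_def L2_norm_scale\<close>)
  qed
  have fa: "L2_pairs m f (\<lambda>n. average (V i) (g n))"
    by (rule L2_pairs_dominated[OF fg]) (use L average_L2[OF L(2) V] in auto)
  define v where "v s = (LINT t|m. indicator (V i) t * fibre_integral f g (s + t)) / of_real (measure m (V i))" for s
  have v_eq: "v s = fibre_integral f (\<lambda>n. average (V i) (g n)) s" for s
    unfolding v_def by (rule fibre_integral_average[OF fg V])
  have diff: "fibre_integral f g s - v s = fibre_integral f h s" for s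
    using fibre_integral_add[OF fg fh fa, of s] by (simp add: v_eq h_def algebra_simps)
  have "v \<in> fourier_algebra m"
  proof -
    define \<kappa> where "\<kappa> t = indicator (V i) t * (1 / complex_of_real (measure m (V i)))" for t
    have \<kappa>: "\<kappa> \<in> L2 m"
    proof (rule L2_of_finite_support[OF _ _ _ V(1,2)[of i]])
      show "\<kappa> \<in> borel_measurable m" unfolding \<kappa>_def[abs_def]
        by (intro borel_measurable_times borel_measurable_indicator) (use V in auto)
      show "cmod (\<kappa> s) \<le> 1 / measure m (V i)" for s
        using Vpos[of i] by (simp add: \<kappa>_def indicator_def norm_divide)
      show "\<kappa> s = 0" if "s \<notin> V i" for s using that by (simp add: \<kappa>_def)
    qed
    have "coefficient m \<kappa> (\<lambda>x. cnj (fibre_integral f g x)) s = v s" for s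
    proof -
      have "coefficient m \<kappa> (\<lambda>x. cnj (fibre_integral f g x)) s
        = (LINT t|m. indicator (V i) t * fibre_integral f g (s + t) * (1 / complex_of_real (measure m (V i))))"
        unfolding coefficient_convolution[OF L2 \<kappa>] by (simp add: \<kappa>_def mult_ac)
      also have "\<dots> = v s" unfolding v_def by simp
      finally show ?thesis .
    qed
    then have "v = coefficient m \<kappa> (\<lambda>x. cnj (fibre_integral f g x))" by auto
    then show ?thesis unfolding fourier_algebra_def using \<kappa> L2_cnj[OF L2] by blast
  qed
  moreover have "coefficient_series m (\<lambda>s. fibre_integral f g s - v s) (\<Sum>n. L2_norm m (f n) * L2_norm m (h n))"
    unfolding diff using fibre_integral_coefficient_series[OF fh] .
  moreover have "(\<Sum>n. L2_norm m (f n) * L2_norm m (h n)) < \<delta>" using i by (simp add: h_def)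
  moreover have "v s = 0" if "\<forall>t\<in>V0. fibre_integral f g (s + t) = 0" for s
  proof -
    have "(\<lambda>t. indicator (V i) t * fibre_integral f g (s + t)) = (\<lambda>t. 0)"
      using that by (auto simp: indicator_def V_def)
    then show ?thesis by (simp add: v_def)
  qed
  ultimately show ?thesis by (rule that)
qed

text \<open>
  Restrict all \<open>f n\<close> to \<open>X k\<close> and all \<open>g n\<close> to \<open>Y k\<close>, with \<open>X k \<times> Y k\<close> covered by finitely many of the
  rectangles.  The rectangles on which \<open>w\<close> vanishes contribute nothing to the fibre integral, so only
  differences from the other ones can carry it.  The error tends to \<open>0\<close> as \<open>k\<close> grows.
\<close>

lemma localisation:
  fixes A B :: "nat \<Rightarrow> 'a set"
  assumes rep: "represents m f g w"
    and A: "\<And>n. A n \<in> sets borel" and B: "\<And>n. B n \<in> sets borel"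
    and cover: "(\<Union>n. A n \<times> B n) = UNIV" and "0 < \<delta>"
  obtains f' g' c N where "L2_pairs m f' g'" "fibre_integral f' g' \<in> L2 m"
    "coefficient_series m (\<lambda>s. fibre_integral f g s - fibre_integral f' g' s) c" "c < \<delta>"
    "\<And>s. \<forall>n<N. \<forall>a\<in>A n. \<forall>b\<in>B n. s = a - b \<longrightarrow> vanishes_mae_on m w (A n \<times> B n)
       \<Longrightarrow> fibre_integral f' g' s = 0"
proof -
  note fg = representsD(1)[OF rep]
  note L = L2_pairsD[OF fg]
  obtain X Y K :: "nat \<Rightarrow> 'a set" and N :: "nat \<Rightarrow> nat"
  where X: "\<And>k. X k \<in> sets borel" and Y: "\<And>k. Y k \<in> sets borel" and K: "\<And>k. compact (K k)"
    and XK: "\<And>k. X k \<subseteq> K k" and YK: "\<And>k. Y k \<subseteq> K k"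
    and N: "\<And>k. X k \<times> Y k \<subseteq> (\<Union>n<N k. A n \<times> B n)"
    and XAE: "AE x in m. \<forall>\<^sub>F k in sequentially. x \<in> X k" and YAE: "AE x in m. \<forall>\<^sub>F k in sequentially. x \<in> Y k"
    by (rule rectangle_cover_essentially_finite[OF A B cover], rule that, assumption+)
  have Xc: "- X k \<in> sets m" and Yc: "- Y k \<in> sets m" for k using X Y by (auto intro: borel_comp)
  have "(\<lambda>k. \<Sum>n. L2_norm m (\<lambda>x. indicator (- X k) x * f n x) * L2_norm m (g n)) \<longlonglongrightarrow> 0"
  proof (rule suminf_tendsto_zero[OF _ _ L(3)])
    show "(\<lambda>k. L2_norm m (\<lambda>x. indicator (- X k) x * f n x) * L2_norm m (g n)) \<longlonglongrightarrow> 0" for n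
      by (rule tendsto_mult_left_zero[OF L2_truncation_converges[OF L(1) X XAE]])
    show "\<bar>L2_norm m (\<lambda>x. indicator (- X k) x * f n x) * L2_norm m (g n)\<bar> \<le> L2_norm m (f n) * L2_norm m (g n)" for n k
      using mult_right_mono[OF L2_indicator(2)[OF L(1) Xc] L2_norm_nonneg[of m "g n"]] by (simp add: abs_mult L2_norm_nonneg)
  qed
  moreover have "(\<lambda>k. \<Sum>n. L2_norm m (f n) * L2_norm m (\<lambda>x. indicator (- Y k) x * g n x)) \<longlonglongrightarrow> 0"
  proof (rule suminf_tendsto_zero[OF _ _ L(3)])
    show "(\<lambda>k. L2_norm m (f n) * L2_norm m (\<lambda>x. indicator (- Y k) x * g n x)) \<longlonglongrightarrow> 0" for n
      by (rule tendsto_mult_right_zero[OF L2_truncation_converges[OF L(2) Y YAE]])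
    show "\<bar>L2_norm m (f n) * L2_norm m (\<lambda>x. indicator (- Y k) x * g n x)\<bar> \<le> L2_norm m (f n) * L2_norm m (g n)" for n k
      using mult_left_mono[OF L2_indicator(2)[OF L(2) Yc] L2_norm_nonneg[of m "f n"]] by (simp add: abs_mult L2_norm_nonneg)
  qed
  ultimately have "(\<lambda>k. (\<Sum>n. L2_norm m (\<lambda>x. indicator (- X k) x * f n x) * L2_norm m (g n))
      + (\<Sum>n. L2_norm m (f n) * L2_norm m (\<lambda>x. indicator (- Y k) x * g n x))) \<longlonglongrightarrow> 0"
    by (rule tendsto_add_zero)
  from order_tendstoD(2)[OF this \<open>0 < \<delta>\<close>]
  obtain k where k: "(\<Sum>n. L2_norm m (\<lambda>x. indicator (- X k) x * f n x) * L2_norm m (g n))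
      + (\<Sum>n. L2_norm m (f n) * L2_norm m (\<lambda>x. indicator (- Y k) x * g n x)) < \<delta>"
    unfolding eventually_sequentially by blast
  define f1 f' g1 g' where "f1 n = (\<lambda>x. indicator (- X k) x * f n x)" and "f' n = (\<lambda>x. indicator (X k) x * f n x)"
    and "g1 n = (\<lambda>x. indicator (- Y k) x * g n x)" and "g' n = (\<lambda>x. indicator (Y k) x * g n x)" for n
  have Xk: "X k \<in> sets m" and Yk: "Y k \<in> sets m" using X Y by auto
  have f1: "f1 n \<in> L2 m" "L2_norm m (f1 n) \<le> L2_norm m (f n)" for n
    unfolding f1_def by (rule L2_indicator[OF L(1) Xc])+
  have f': "f' n \<in> L2 m" "L2_norm m (f' n) \<le> L2_norm m (f n)" for n
    unfolding f'_def by (rule L2_indicator[OF L(1) Xk])+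
  have g1: "g1 n \<in> L2 m" "L2_norm m (g1 n) \<le> L2_norm m (g n)" for n
    unfolding g1_def by (rule L2_indicator[OF L(2) Yc])+
  have g': "g' n \<in> L2 m" "L2_norm m (g' n) \<le> L2_norm m (g n)" for n
    unfolding g'_def by (rule L2_indicator[OF L(2) Yk])+
  have P1: "L2_pairs m f1 g" by (rule L2_pairs_dominated[OF fg]) (use f1 L in auto)
  have P2: "L2_pairs m f' g" by (rule L2_pairs_dominated[OF fg]) (use f' L in auto)
  have P3: "L2_pairs m f' g1" by (rule L2_pairs_dominated[OF fg]) (use f' g1 in auto)
  have P4: "L2_pairs m f' g'" by (rule L2_pairs_dominated[OF fg]) (use f' g' in auto)
  have split: "fibre_integral f g s - fibre_integral f' g' s = fibre_integral f1 g s + fibre_integral f' g1 s" for s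
  proof -
    have "fibre_integral f g s = fibre_integral f1 g s + fibre_integral f' g s"
      by (rule fibre_integral_add[OF fg P1 P2]) (simp add: f1_def f'_def indicator_def)
    moreover have "fibre_integral f' g s = fibre_integral f' g1 s + fibre_integral f' g' s"
      by (rule fibre_integral_add[OF P2 P3 P4]) (simp add: g1_def g'_def indicator_def)
    ultimately show ?thesis by simp
  qed
  define c where "c = (\<Sum>n. L2_norm m (f1 n) * L2_norm m (g n)) + (\<Sum>n. L2_norm m (f' n) * L2_norm m (g1 n))"
  have series: "coefficient_series m (\<lambda>s. fibre_integral f g s - fibre_integral f' g' s) c"
    unfolding split c_def by (intro coefficient_series_add fibre_integral_coefficient_series P1 P3)
  have "(\<Sum>n. L2_norm m (f' n) * L2_norm m (g1 n)) \<le> (\<Sum>n. L2_norm m (f n) * L2_norm m (g1 n))"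
  proof (rule suminf_le)
    show "L2_norm m (f' n) * L2_norm m (g1 n) \<le> L2_norm m (f n) * L2_norm m (g1 n)" for n
      by (rule mult_right_mono[OF f'(2) L2_norm_nonneg])
    show "summable (\<lambda>n. L2_norm m (f' n) * L2_norm m (g1 n))" by (rule L2_pairsD(3)[OF P3])
    show "summable (\<lambda>n. L2_norm m (f n) * L2_norm m (g1 n))"
      by (rule L2_pairsD(3), rule L2_pairs_dominated[OF fg]) (use L g1 in auto)
  qed
  then have c: "c < \<delta>" using k by (simp add: c_def f1_def g1_def)
  have L2: "fibre_integral f' g' \<in> L2 m"
  proof (rule L2_of_finite_support[OF fibre_integral_measurable[OF P4] fibre_integral_bounded[OF P4]])
    define S where "S = (\<lambda>p. fst p + - snd p) ` (K k \<times> K k)"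
    have "compact S" unfolding S_def
      by (intro compact_continuous_image compact_Times K continuous_intros)
    then show "S \<in> sets borel" "emeasure m S < \<infinity>" using compact_borel emeasure_compact by auto
    fix s assume s: "s \<notin> S"
    have "f' n (s + y) * g' n y = 0" for n y
    proof -
      have "s + y \<notin> X k \<or> y \<notin> Y k"
      proof (rule ccontr)
        assume "\<not> (s + y \<notin> X k \<or> y \<notin> Y k)"
        then have "(s + y, y) \<in> K k \<times> K k" using XK YK by blast
        then have "s + y + - y \<in> S" unfolding S_def by (intro image_eqI[of _ _ "(s + y, y)"]) auto
        then show False using s by (simp add: add.assoc)
      qed
      then show ?thesis by (auto simp: f'_def g'_def)
    qed
    then have "(\<lambda>y. \<Sum>n. f' n (s + y) * g' n y) = (\<lambda>y. 0)"
      by (simp only: suminf_zero)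
    then show "fibre_integral f' g' s = 0" by (simp add: fibre_integral_def)
  qed
  have vanish: "fibre_integral f' g' s = 0"
    if s: "\<forall>n<N k. \<forall>a\<in>A n. \<forall>b\<in>B n. s = a - b \<longrightarrow> vanishes_mae_on m w (A n \<times> B n)" for s
  proof -
    have "AE y in m. \<forall>n. vanishes_mae_on m w (A n \<times> B n) \<longrightarrow> (s + y, y) \<notin> {p \<in> A n \<times> B n. w p \<noteq> 0}"
      unfolding AE_all_countable
    proof
      fix n
      show "AE y in m. vanishes_mae_on m w (A n \<times> B n) \<longrightarrow> (s + y, y) \<notin> {p \<in> A n \<times> B n. w p \<noteq> 0}"
      proof (cases "vanishes_mae_on m w (A n \<times> B n)")
        case True
        then show ?thesis
          using marginally_null_fibre[of "{p \<in> A n \<times> B n. w p \<noteq> 0}" s] unfolding vanishes_mae_on_def by simp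
      qed simp
    qed
    moreover have "AE y in m. (\<lambda>n. f n (s + y) * g n y) sums w (s + y, y)" by (rule represents_fibre[OF rep])
    ultimately have "AE y in m. (\<Sum>n. f' n (s + y) * g' n y) = 0"
    proof eventually_elim
      case (elim y)
      show ?case
      proof (cases "s + y \<in> X k \<and> y \<in> Y k")
        case True
        then obtain n where n: "n < N k" "s + y \<in> A n" "y \<in> B n" using N[of k] by blast
        have "s = s + y - y" by simp
        then have "vanishes_mae_on m w (A n \<times> B n)" using s n by blast
        then have "w (s + y, y) = 0" using elim(1) n by auto
        then show ?thesis using elim(2) True by (simp add: f'_def g'_def sums_iff)
      next
        case False
        then have "f' n (s + y) * g' n y = 0" for n by (auto simp: f'_def g'_def)
        then show ?thesis by (simp only: suminf_zero)
      qed
    qed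
    then show ?thesis unfolding fibre_integral_def by (rule integral_eq_zero_AE)
  qed
  show ?thesis by (rule that[OF P4 L2 series c vanish])
qed

text \<open>
  The error \<open>\<epsilon>\<close> is spent in equal parts on synthesis, localisation and mollification.
\<close>

lemma operator_synthesis_approximation:
  assumes "closed E" and syn: "operator_synthetic m (star_set E)" and u: "u \<in> I_A_c m E" and "0 < \<epsilon>"
  shows "\<exists>v\<in>J_A_0 m E. fourier_norm m (\<lambda>s. u s - v s) < \<epsilon>"
proof -
  have uA: "u \<in> fourier_algebra m" and uE: "\<And>s. s \<in> E \<Longrightarrow> u s = 0" and supp: "compact (closure {s. u s \<noteq> 0})"
    using u by (auto simp: I_A_c_def I_A_def)
  have e3: "0 < \<epsilon> / 3" using \<open>0 < \<epsilon>\<close> by simp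
  obtain f0 g0 w0 where r0: "represents m f0 g0 w0" and f0: "\<And>s. fibre_integral f0 g0 s = u s"
    and w0: "\<And>x y. u (x - y) = 0 \<Longrightarrow> w0 (x, y) = 0"
    using lift_to_tensor_square[OF uA supp] by metis
  have "{p \<in> star_set E. w0 p \<noteq> 0} = {}" using w0 uE by (auto simp: star_set_def)
  then have "vanishes_mae_on m w0 (star_set E)"
    unfolding vanishes_mae_on_def by (simp only: marginally_null_empty)
  then have "w0 \<in> Phi m (star_set E)"
    using r0 by (auto simp: Phi_def T_space_def)
  then have "w0 \<in> Phi_0 m (star_set E)" using syn by (simp add: operator_synthetic_def)
  then obtain w1 U where "w1 \<in> T_space m" and U: "pseudo_neighbourhood m (star_set E) U"
    and w1U: "vanishes_mae_on m w1 U" and T: "T_norm m (\<lambda>p. w0 p - w1 p) < \<epsilon> / 3"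
    using e3 unfolding Phi_0_def by blast
  then obtain f1 g1 where r1: "represents m f1 g1 w1" by (auto simp: T_space_def)
  obtain f3 g3 where "represents m f3 g3 (\<lambda>p. w0 p - w1 p)" using represents_diff[OF r0 r1] by blast
  then obtain f2 g2 where r2: "represents m f2 g2 (\<lambda>p. w0 p - w1 p)"
    and small: "(\<Sum>n. L2_norm m (f2 n) * L2_norm m (g2 n)) < \<epsilon> / 3"
    using T by (rule T_norm_lessD)
  have series2: "coefficient_series m (\<lambda>s. u s - fibre_integral f1 g1 s) (\<Sum>n. L2_norm m (f2 n) * L2_norm m (g2 n))"
    using fibre_integral_coefficient_series[OF representsD(1)[OF r2]] fibre_integral_diff_represents[OF r0 r1 r2]
    by (simp add: f0 cong: coefficient_series_def)

  obtain A B where AB: "\<And>n::nat. A n \<in> sets m" "\<And>n. B n \<in> sets m"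
    and eqv: "marginally_null m ((U - (\<Union>n. A n \<times> B n)) \<union> ((\<Union>n. A n \<times> B n) - U))"
    and EU: "marginally_null m (star_set E - U)"
    using U unfolding pseudo_neighbourhood_def pseudo_open_def marginally_equivalent_def by blast
  have "marginally_null m (star_set E - (\<Union>n. A n \<times> B n))"
    by (rule marginally_null_subset[OF marginally_null_Un[OF eqv EU]]) blast
  then obtain M M' where M: "M \<in> null_sets m" "M' \<in> null_sets m"
    "star_set E - (\<Union>n. A n \<times> B n) \<subseteq> (M \<times> UNIV) \<union> (UNIV \<times> M')"
    unfolding marginally_null_def by blast
  have AB0: "vanishes_mae_on m w1 (A n \<times> B n)" for n
    unfolding vanishes_mae_on_def
    by (rule marginally_null_subset[OF marginally_null_Un[OF eqv w1U[unfolded vanishes_mae_on_def]]]) blast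
  have null: "marginally_null m S" if "S \<subseteq> (M \<times> UNIV) \<union> (UNIV \<times> M')" for S
    unfolding marginally_null_def using M(1,2) that by blast
  have M0: "vanishes_mae_on m w1 (M \<times> UNIV)" "vanishes_mae_on m w1 (UNIV \<times> M')"
    unfolding vanishes_mae_on_def by (rule null, blast)+

  obtain \<R> where \<R>: "countable \<R>" "\<Union>((\<lambda>(A, B). A \<times> B) ` \<R>) = - star_set E"
    "\<And>A B. (A, B) \<in> \<R> \<Longrightarrow> open A \<and> open B \<and>
       (\<exists>W. open W \<and> 0 \<in> W \<and> (\<forall>a\<in>A. \<forall>b\<in>B. \<forall>t\<in>W. a - b - t \<notin> E))"
    using rectangles_avoiding_closed_set[OF \<open>closed E\<close>] by metis
  \<comment> \<open>The exceptional marginally null set is itself a union of two rectangles, and \<open>w1\<close> trivially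
    vanishes marginally almost everywhere on them; adding them gives an honest cover of the square.\<close>
  define \<C> where "\<C> = {(M, UNIV), (UNIV, M')} \<union> range (\<lambda>n. (A n, B n)) \<union> \<R>"
  have \<C>: "countable \<C>" "\<C> \<noteq> {}" using \<R>(1) by (auto simp: \<C>_def)
  define P where "P = from_nat_into \<C>"
  have range: "range P = \<C>" unfolding P_def using range_from_nat_into[OF \<C>(2,1)] .
  have PC: "P n \<in> \<C>" for n using range by blast
  have PB: "fst (P n) \<in> sets borel \<and> snd (P n) \<in> sets borel" for n
    using PC[of n] M AB \<R>(3)[of "fst (P n)" "snd (P n)"] by (auto simp: \<C>_def null_sets_def)
  have cover: "(\<Union>n. fst (P n) \<times> snd (P n)) = UNIV"
  proof -
    have "(\<Union>n. fst (P n) \<times> snd (P n)) = (\<Union>p\<in>\<C>. fst p \<times> snd p)" unfolding range[symmetric] by blast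
    also have "\<dots> = UNIV"
    proof -
      have "p \<in> (\<Union>p\<in>\<C>. fst p \<times> snd p)" for p
      proof (cases "p \<in> star_set E")
        case True
        then show ?thesis using M(3) unfolding \<C>_def by (cases p) auto
      next
        case False
        then have "p \<in> \<Union>((\<lambda>(A, B). A \<times> B) ` \<R>)" using \<R>(2) by blast
        then show ?thesis unfolding \<C>_def by force
      qed
      then show ?thesis by blast
    qed
    finally show ?thesis .
  qed
  obtain f' g' c N where fg': "L2_pairs m f' g'" and L2: "fibre_integral f' g' \<in> L2 m"
    and series1: "coefficient_series m (\<lambda>s. fibre_integral f1 g1 s - fibre_integral f' g' s) c" and c: "c < \<epsilon> / 3"
    and zero: "\<And>s. \<forall>n<N. \<forall>a\<in>fst (P n). \<forall>b\<in>snd (P n). s = a - b \<longrightarrow>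
         vanishes_mae_on m w1 (fst (P n) \<times> snd (P n)) \<Longrightarrow> fibre_integral f' g' s = 0"
    by (rule localisation[OF r1 PB[THEN conjunct1] PB[THEN conjunct2] cover e3], rule that, assumption+)

  have "\<exists>W. open W \<and> 0 \<in> W \<and> (vanishes_mae_on m w1 (fst (P n) \<times> snd (P n)) \<or>
      (\<forall>a\<in>fst (P n). \<forall>b\<in>snd (P n). \<forall>t\<in>W. a - b - t \<notin> E))" for n
  proof (cases "P n \<in> \<R>")
    case True
    then show ?thesis using \<R>(3)[of "fst (P n)" "snd (P n)"] by auto
  next
    case False
    then have "vanishes_mae_on m w1 (fst (P n) \<times> snd (P n))" using PC[of n] AB0 M0 by (auto simp: \<C>_def)
    then show ?thesis by (intro exI[of _ UNIV]) auto
  qed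
  then obtain W where W: "\<And>n. open (W n)" "\<And>n. 0 \<in> W n"
    "\<And>n. vanishes_mae_on m w1 (fst (P n) \<times> snd (P n)) \<or> (\<forall>a\<in>fst (P n). \<forall>b\<in>snd (P n). \<forall>t\<in>W n. a - b - t \<notin> E)"
    by metis
  \<comment> \<open>Room of size \<open>W\<close> must accommodate two displacements: the one of the averaging and the distance
    that a point of the neighbourhood of \<open>E\<close> has from \<open>E\<close>.  Hence \<open>V + V\<close> has to fit into \<open>W\<close>.\<close>
  have "((\<lambda>p. fst p + snd p) \<longlongrightarrow> 0 + 0) (nhds 0 \<times>\<^sub>F nhds (0::'a))"
    by (intro tendsto_add filterlim_fst filterlim_snd)
  then have "\<forall>\<^sub>F p in nhds 0 \<times>\<^sub>F nhds (0::'a). fst p + snd p \<in> (\<Inter>n<N. W n)"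
    by (rule topological_tendstoD) (use W in auto)
  then obtain Q Q' where Q: "\<forall>\<^sub>F a in nhds (0::'a). Q a" "\<forall>\<^sub>F a in nhds (0::'a). Q' a"
    "\<And>a b. Q a \<Longrightarrow> Q' b \<Longrightarrow> a + b \<in> (\<Inter>n<N. W n)"
    unfolding eventually_prod_filter by auto
  have "\<forall>\<^sub>F a in nhds (0::'a). Q a \<and> Q' a" using Q(1,2) by (rule eventually_conj)
  then obtain V where V: "open V" "0 \<in> V" "\<And>a. a \<in> V \<Longrightarrow> Q a \<and> Q' a" unfolding eventually_nhds by blast
  obtain v d where v: "v \<in> fourier_algebra m" and series0: "coefficient_series m (\<lambda>s. fibre_integral f' g' s - v s) d"
    and d: "d < \<epsilon> / 3" and v0: "\<And>s. \<forall>t\<in>V. fibre_integral f' g' (s + t) = 0 \<Longrightarrow> v s = 0"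
    by (rule mollification[OF fg' L2 V(1,2) e3], rule that, assumption+)

  have "v \<in> J_A_0 m E"
    unfolding J_A_0_def mem_Collect_eq
  proof (intro conjI v exI)
    show "open (\<Union>e\<in>E. (\<lambda>x. - e + x) -` V)"
      using V(1) by (intro open_UN ballI open_vimage) (auto simp: continuous_on_def intro!: tendsto_intros)
    show "E \<subseteq> (\<Union>e\<in>E. (\<lambda>x. - e + x) -` V)" using V(2) by auto
    show "\<forall>s\<in>\<Union>e\<in>E. (\<lambda>x. - e + x) -` V. v s = 0"
    proof
      fix s assume "s \<in> (\<Union>e\<in>E. (\<lambda>x. - e + x) -` V)"
      then obtain e where e: "e \<in> E" "- e + s \<in> V" by blast
      show "v s = 0"
      proof (rule v0, rule ballI, rule zero, intro allI ballI impI)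
        fix t n a b assume t: "t \<in> V" and n: "n < N" "a \<in> fst (P n)" "b \<in> snd (P n)" and st: "s + t = a - b"
        have "(- e + s) + t \<in> W n" using Q(3)[of "- e + s" t] V(3) e t n by blast
        moreover have "a - b - ((- e + s) + t) = e"
          unfolding st[symmetric] by (simp add: add.assoc diff_conv_add_uminus minus_add del: add_uminus_conv_diff)
        ultimately show "vanishes_mae_on m w1 (fst (P n) \<times> snd (P n))" using W(3)[of n] n e(1) by metis
      qed
    qed
  qed
  moreover have "fourier_norm m (\<lambda>s. u s - v s) < \<epsilon>"
  proof -
    have "coefficient_series m (\<lambda>s. (u s - fibre_integral f1 g1 s) +
          ((fibre_integral f1 g1 s - fibre_integral f' g' s) + (fibre_integral f' g' s - v s)))
        ((\<Sum>n. L2_norm m (f2 n) * L2_norm m (g2 n)) + (c + d))"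
      by (intro coefficient_series_add series2 series1 series0)
    then have "fourier_norm m (\<lambda>s. u s - v s) \<le> (\<Sum>n. L2_norm m (f2 n) * L2_norm m (g2 n)) + (c + d)"
      by (intro fourier_norm_le) simp
    then show ?thesis using small c d by linarith
  qed
  ultimately show ?thesis by blast
qed

end

theorem theorem4p3:
  fixes m :: "'a::{topological_group_add, t2_space, second_countable_topology} measure"
    and E :: "'a set"
  assumes "locally_compact_space (euclidean :: 'a topology)"
    and "left_haar_measure m"
    and "closed E"
    and "operator_synthetic m (star_set E)"
  shows "local_spectral_synthesis m E"
proof -
  interpret haar_group m by standard (fact assms(1,2))+
  show ?thesis
    using operator_synthesis_approximation[OF assms(3,4)]
    by (auto simp: local_spectral_synthesis_def J_A_def I_A_c_def I_A_def)
qed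

end
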